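(* Let $p=2m$ be even, $m=2,3,4,\dots$. Then $$K(2m)=\sum_{l=0}^{2m}(-1)^l\binom{2m}{l}\sum_{q=0}^{2m-l}\sum_{r=0}^{l}2^{-r-q}\,s(2m-l,q)\,s(l,r),$$ $$C(2m)^{2m}=L(2m)=\sum_{l=0}^{2m}(-1)^l\binom{2m}{l}\sum_{r=0}^{2m-l}s(2m-l,r).$$ For odd integers $p=5,7,9,\dots$, $$G(p)^p=L(p)=\frac2e+\sum_{k=0}^p(-1)^k\binom pk B_1(p-k).$$
   Context: $s(n,r)$ are the Stirling numbers of the second kind, defined by $x^n=\sum_{r=0}^ns(n,r)\,x(x-1)\cdots(x-r+1)$ (the empty product for $r=0$ being $1$). $B_1(p)=e^{-1}\sum_{n=0}^\infty\frac{n^p}{n!}$, with the convention $0^0=1$, so $B_1(0)=1$. For $p\ge4$: $L(p)=e^{-1}\sum_{n=0}^\infty\frac{|n-1|^p}{n!}$ and $G(p)=L(p)^{1/p}$. For a random variable $\xi$, $\|\xi\|_p=(\mathbf{E}|\xi|^p)^{1/p}$. For $p\ge2$, $$C(p)=\sup_{\{\xi(i)\}}\sup_n\frac{\|\sum_{i=1}^n\xi(i)\|_p}{\max\left(\|\sum_{i=1}^n\xi(i)\|_2,\ \left(\sum_{i=1}^n\|\xi(i)\|_p^p\right)^{1/p}\right)},$$ where the outer supremum is over all sequences of independent real random variables with $\mathbf{E}\xi(i)=0$ and $\|\xi(i)\|_p<\infty$ for all $i$ (with nonzero denominator). $S(p)$ is defined by the same formula with the outer supremum restricted to sequences of independent,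 symmetrically distributed random variables with $\|\xi(i)\|_p<\infty$, and $K(p)=S(p)^p$. *)

theory Defs
  imports "HOL-Probability.Probability" "HOL-Combinatorics.Stirling"
begin

section \<open>Stirling numbers of the second kind\<close>

text \<open>The library defines \<^const>\<open>Stirling\<close> by recursion. The next two lemmas show that it is the
  unique family satisfying the defining identity
  \<open>x^n = (\<Sum>r\<le>n. s(n,r) x (x - 1) \<dots> (x - r + 1))\<close>.\<close>

lemma Stirling_falling_factorial:
  fixes x :: real
  shows "x ^ n = (\<Sum>r\<le>n. real (Stirling n r) * (\<Prod>i<r. x - real i))"
proof (induction n)
  case 0
  then show ?case by simp
next
  case (Suc n)
  let ?f = "\<lambda>r. \<Prod>i<r. x - real i"
  have f: "x * ?f r = ?f (Suc r) + real r * ?f r" for r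
    by (simp add: algebra_simps)
  have "(\<Sum>r\<le>Suc n. real (Stirling (Suc n) r) * ?f r)
      = (\<Sum>r\<le>n. real (Stirling (Suc n) (Suc r)) * ?f (Suc r))"
    by (simp add: sum.atMost_Suc_shift del: prod.lessThan_Suc Stirling.simps(4) sum.atMost_Suc)
  also have "\<dots> = (\<Sum>r\<le>n. real (Suc r) * real (Stirling n (Suc r)) * ?f (Suc r))
      + (\<Sum>r\<le>n. real (Stirling n r) * ?f (Suc r))"
    by (simp add: algebra_simps sum.distrib del: prod.lessThan_Suc sum.atMost_Suc)
  also have "(\<Sum>r\<le>n. real (Suc r) * real (Stirling n (Suc r)) * ?f (Suc r))
      = (\<Sum>r\<le>Suc n. real r * real (Stirling n r) * ?f r)"
    by (subst sum.atMost_Suc_shift) (simp del: prod.lessThan_Suc of_nat_Suc sum.atMost_Suc)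
  also have "\<dots> = (\<Sum>r\<le>n. real r * real (Stirling n r) * ?f r)"
    by simp
  also have "\<dots> + (\<Sum>r\<le>n. real (Stirling n r) * ?f (Suc r))
      = (\<Sum>r\<le>n. real (Stirling n r) * (x * ?f r))"
    unfolding f by (simp add: algebra_simps sum.distrib del: prod.lessThan_Suc)
  also have "\<dots> = x * x ^ n"
    unfolding Suc.IH by (simp add: sum_distrib_left mult_ac)
  finally show ?case by simp
qed

lemma Stirling_unique:
  fixes s :: "nat \<Rightarrow> real"
  assumes s: "\<And>x::real. x ^ n = (\<Sum>r\<le>n. s r * (\<Prod>i<r. x - real i))"
    and "r \<le> n"
  shows "s r = real (Stirling n r)"
  using \<open>r \<le> n\<close>
proof (induction r rule: less_induct)
  case (less r)
  define d where "d = (\<lambda>k. s k - real (Stirling n k))"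
  let ?f = "\<lambda>k. \<Prod>i<k. real r - real i"
  have vanish: "?f k = 0" if "k > r" for k
    using that by (auto intro!: prod_zero)
  have nz: "?f r \<noteq> 0" by simp
  have "0 = (\<Sum>k\<le>n. d k * ?f k)"
    using s[of "real r"] Stirling_falling_factorial[of "real r" n]
    by (simp add: d_def left_diff_distrib sum_subtractf)
  also have "\<dots> = (\<Sum>k\<in>{r}. d k * ?f k)"
  proof (rule sum.mono_neutral_right)
    show "\<forall>k\<in>{..n} - {r}. d k * ?f k = 0"
    proof
      fix k assume k: "k \<in> {..n} - {r}"
      then consider "k < r" | "k > r" by fastforce
      then show "d k * ?f k = 0"
      proof cases
        case 1
        then have "d k = 0" using less.IH[of k] k by (auto simp: d_def)
        then show ?thesis by simp
      next
        case 2
        show ?thesis by (simp only: vanish[OF 2] mult_zero_right)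
      qed
    qed
  qed (use less.prems in auto)
  finally have "d r * ?f r = 0" by simp
  with nz have "d r = 0" by (simp only: mult_eq_0_iff) blast
  then show ?case by (simp add: d_def)
qed

section \<open>The explicit series\<close>

text \<open>For a natural exponent, \<open>0 ^ 0 = 1\<close> holds in HOL.\<close>

definition B1 :: "nat \<Rightarrow> real" where
  "B1 p = exp (-1) * (\<Sum>n. real n ^ p / fact n)"

definition L_fun :: "real \<Rightarrow> real" where
  "L_fun p = exp (-1) * (\<Sum>n. \<bar>real n - 1\<bar> powr p / fact n)"

definition G_fun :: "real \<Rightarrow> real" where
  "G_fun p = L_fun p powr (1 / p)"

section \<open>The constants in the Rosenthal inequality\<close>

text \<open>Only meaningful if \<open>|\<xi>|^p\<close> is integrable; \<open>centred_seq\<close> and \<open>symmetric_seq\<close> below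
  require this explicitly.\<close>

definition pnorm :: "'a measure \<Rightarrow> real \<Rightarrow> ('a \<Rightarrow> real) \<Rightarrow> real" where
  "pnorm M p \<xi> = (\<integral>\<omega>. \<bar>\<xi> \<omega>\<bar> powr p \<partial>M) powr (1 / p)"

definition rosenthal_denom :: "'a measure \<Rightarrow> (nat \<Rightarrow> 'a \<Rightarrow> real) \<Rightarrow> real \<Rightarrow> nat \<Rightarrow> real" where
  "rosenthal_denom M \<xi> p n =
     max (pnorm M 2 (\<lambda>\<omega>. \<Sum>i<n. \<xi> i \<omega>)) ((\<Sum>i<n. pnorm M p (\<xi> i) powr p) powr (1 / p))"

definition rosenthal_ratio :: "'a measure \<Rightarrow> (nat \<Rightarrow> 'a \<Rightarrow> real) \<Rightarrow> real \<Rightarrow> nat \<Rightarrow> real" where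
  "rosenthal_ratio M \<xi> p n = pnorm M p (\<lambda>\<omega>. \<Sum>i<n. \<xi> i \<omega>) / rosenthal_denom M \<xi> p n"

definition indep_seq_Lp :: "'a measure \<Rightarrow> (nat \<Rightarrow> 'a \<Rightarrow> real) \<Rightarrow> real \<Rightarrow> bool" where
  "indep_seq_Lp M \<xi> p \<longleftrightarrow> prob_space M \<and> prob_space.indep_vars M (\<lambda>_. borel) \<xi> UNIV \<and>
     (\<forall>i. integrable M (\<lambda>\<omega>. \<bar>\<xi> i \<omega>\<bar> powr p))"

definition centred_seq :: "'a measure \<Rightarrow> (nat \<Rightarrow> 'a \<Rightarrow> real) \<Rightarrow> real \<Rightarrow> bool" where
  "centred_seq M \<xi> p \<longleftrightarrow> indep_seq_Lp M \<xi> p \<and> (\<forall>i. (\<integral>\<omega>. \<xi> i \<omega> \<partial>M) = 0)"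

definition symmetric_seq :: "'a measure \<Rightarrow> (nat \<Rightarrow> 'a \<Rightarrow> real) \<Rightarrow> real \<Rightarrow> bool" where
  "symmetric_seq M \<xi> p \<longleftrightarrow> indep_seq_Lp M \<xi> p \<and>
     (\<forall>i. distr M borel (\<lambda>\<omega>. - \<xi> i \<omega>) = distr M borel (\<xi> i))"

text \<open>One cannot quantify over the types of all sample spaces inside a term, so the suprema range
  over all probability spaces whose sample space has type \<^typ>\<open>nat \<Rightarrow> real\<close>. By
  \<open>centred_seq_canonical\<close> and \<open>symmetric_seq_canonical\<close> below, no sequence on any other sample space
  is lost. The suprema are extended reals, so that their finiteness is not presupposed. The
  condition on \<open>n\<close> excludes zero denominators (in particular \<open>n = 0\<close>).\<close>

definition Rosenthal_C :: "real \<Rightarrow> ereal" where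
  "Rosenthal_C p =
     (SUP (M, \<xi>) \<in> {(M :: (nat \<Rightarrow> real) measure, \<xi>). centred_seq M \<xi> p}.
        SUP n \<in> {n. rosenthal_denom M \<xi> p n \<noteq> 0}. ereal (rosenthal_ratio M \<xi> p n))"

definition Rosenthal_S :: "real \<Rightarrow> ereal" where
  "Rosenthal_S p =
     (SUP (M, \<xi>) \<in> {(M :: (nat \<Rightarrow> real) measure, \<xi>). symmetric_seq M \<xi> p}.
        SUP n \<in> {n. rosenthal_denom M \<xi> p n \<noteq> 0}. ereal (rosenthal_ratio M \<xi> p n))"

definition Rosenthal_K :: "nat \<Rightarrow> ereal" where
  "Rosenthal_K p = Rosenthal_S (real p) ^ p"

subsection \<open>Independence of the choice of sample space\<close>

definition seq_law :: "'a measure \<Rightarrow> (nat \<Rightarrow> 'a \<Rightarrow> real) \<Rightarrow> (nat \<Rightarrow> real) measure" where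
  "seq_law M \<xi> = distr M (\<Pi>\<^sub>M i\<in>UNIV. borel) (\<lambda>\<omega> i. \<xi> i \<omega>)"

context
  fixes M :: "'a measure" and \<xi> :: "nat \<Rightarrow> 'a \<Rightarrow> real" and p :: real
  assumes seq: "indep_seq_Lp M \<xi> p"
begin

private lemma rv [measurable]: "\<xi> i \<in> borel_measurable M"
  using seq by (auto simp: indep_seq_Lp_def prob_space.indep_vars_def)

private lemma joint [measurable]: "(\<lambda>\<omega> i. \<xi> i \<omega>) \<in> measurable M (\<Pi>\<^sub>M i\<in>UNIV. borel)"
  by (rule measurable_PiM_single') auto

private lemma coord [measurable]: "(\<lambda>f :: nat \<Rightarrow> real. f i) \<in> borel_measurable (\<Pi>\<^sub>M i\<in>UNIV. borel)"
  by (rule measurable_component_singleton) simp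

private lemma coord_law [measurable]: "(\<lambda>f :: nat \<Rightarrow> real. f i) \<in> borel_measurable (seq_law M \<xi>)"
  by (simp add: seq_law_def)

private lemma seq_law_pnorm:
  assumes [measurable]: "g \<in> borel_measurable (\<Pi>\<^sub>M i\<in>UNIV. borel)"
  shows "pnorm (seq_law M \<xi>) q g = pnorm M q (\<lambda>\<omega>. g (\<lambda>i. \<xi> i \<omega>))"
  unfolding pnorm_def seq_law_def by (subst integral_distr[OF joint]) simp_all

lemma seq_law_ratio:
  "rosenthal_denom (seq_law M \<xi>) (\<lambda>i f. f i) p n = rosenthal_denom M \<xi> p n"
  "rosenthal_ratio (seq_law M \<xi>) (\<lambda>i f. f i) p n = rosenthal_ratio M \<xi> p n"
  unfolding rosenthal_denom_def rosenthal_ratio_def by (simp_all add: seq_law_pnorm)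

private lemma distr_coord:
  assumes [measurable]: "h \<in> borel_measurable borel"
  shows "distr (seq_law M \<xi>) borel (\<lambda>f. h (f i)) = distr M borel (\<lambda>\<omega>. h (\<xi> i \<omega>) :: real)"
  unfolding seq_law_def by (subst distr_distr) (simp_all add: comp_def)

lemma seq_law_indep: "indep_seq_Lp (seq_law M \<xi>) (\<lambda>i f. f i) p"
proof -
  interpret prob_space M using seq by (simp add: indep_seq_Lp_def)
  have ps: "prob_space (seq_law M \<xi>)"
    unfolding seq_law_def by (rule prob_space_distr) simp
  have "indep_vars (\<lambda>_. borel) \<xi> UNIV" using seq by (simp add: indep_seq_Lp_def)
  then have "seq_law M \<xi> = (\<Pi>\<^sub>M i\<in>UNIV. distr M borel (\<xi> i))"
    using indep_vars_iff_distr_eq_PiM[of UNIV \<xi> "\<lambda>_. borel"] by (simp add: seq_law_def restrict_def)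
  moreover have "distr (seq_law M \<xi>) (\<Pi>\<^sub>M i\<in>UNIV. borel) (\<lambda>f. f) = seq_law M \<xi>"
    by (rule distr_id2) (simp add: seq_law_def)
  ultimately have "prob_space.indep_vars (seq_law M \<xi>) (\<lambda>_. borel) (\<lambda>i f. f i) UNIV"
    using distr_coord[of "\<lambda>x. x"]
    by (subst prob_space.indep_vars_iff_distr_eq_PiM[OF ps]) (simp_all add: restrict_def)
  moreover have "integrable (seq_law M \<xi>) (\<lambda>f. \<bar>f i\<bar> powr p)" for i
    using seq unfolding seq_law_def by (subst integrable_distr_eq) (simp_all add: indep_seq_Lp_def)
  ultimately show ?thesis using ps by (simp add: indep_seq_Lp_def)
qed

lemma seq_law_mean: "(\<integral>f. f i \<partial>seq_law M \<xi>) = (\<integral>\<omega>. \<xi> i \<omega> \<partial>M)"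
  unfolding seq_law_def by (subst integral_distr) simp_all

lemma seq_law_symmetric:
  assumes "distr M borel (\<lambda>\<omega>. - \<xi> i \<omega>) = distr M borel (\<xi> i)"
  shows "distr (seq_law M \<xi>) borel (\<lambda>f. - f i) = distr (seq_law M \<xi>) borel (\<lambda>f. f i)"
  using assms distr_coord[of "\<lambda>x. x" i] distr_coord[of uminus i] by simp

end

theorem centred_seq_canonical:
  fixes M :: "'a measure"
  assumes "centred_seq M \<xi> p" and "rosenthal_denom M \<xi> p n \<noteq> 0"
  shows "ereal (rosenthal_ratio M \<xi> p n) \<le> Rosenthal_C p"
proof -
  have i: "indep_seq_Lp M \<xi> p" using assms by (simp add: centred_seq_def)
  have c: "centred_seq (seq_law M \<xi>) (\<lambda>i f. f i) p"
    using assms(1) seq_law_indep[OF i] seq_law_mean[OF i] by (simp add: centred_seq_def)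
  show ?thesis
    unfolding Rosenthal_C_def
    by (rule SUP_upper2[where i = "(seq_law M \<xi>, \<lambda>i f. f i)"], use c in simp, simp,
        rule SUP_upper2[where i = n]) (use assms seq_law_ratio[OF i] in simp_all)
qed

theorem symmetric_seq_canonical:
  fixes M :: "'a measure"
  assumes "symmetric_seq M \<xi> p" and "rosenthal_denom M \<xi> p n \<noteq> 0"
  shows "ereal (rosenthal_ratio M \<xi> p n) \<le> Rosenthal_S p"
proof -
  have i: "indep_seq_Lp M \<xi> p" using assms by (simp add: symmetric_seq_def)
  have c: "symmetric_seq (seq_law M \<xi>) (\<lambda>i f. f i) p"
    using assms(1) seq_law_indep[OF i] seq_law_symmetric[OF i] by (simp add: symmetric_seq_def)
  show ?thesis
    unfolding Rosenthal_S_def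
    by (rule SUP_upper2[where i = "(seq_law M \<xi>, \<lambda>i f. f i)"], use c in simp, simp,
        rule SUP_upper2[where i = n]) (use assms seq_law_ratio[OF i] in simp_all)
qed

end

theory Submission
  imports Defs
begin

text \<open>The exponential generating function of the moments of a sum of independent \<open>\<xi>\<^sub>i\<close>
  is the product of those of the summands, and \<open>1 + A \<le> exp A\<close> holds coefficientwise for \<open>A\<close> with
  nonnegative coefficients. After normalising the denominator to 1, Young's inequality
  \<open>\<bar>x\<bar>^k \<le> \<lambda> x\<^sup>2 + (1 - \<lambda>) \<bar>x\<bar>^p\<close> bounds \<open>\<Sum>\<^sub>i \<bar>E \<xi>\<^sub>i^k\<bar>\<close> by 1 for \<open>2 \<le> k \<le> p\<close>,
  so the \<open>p\<close>-th moment of the sum is at most \<open>p!\<close> times the coefficient of \<open>z^p\<close> in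
  \<open>exp (\<Sum>\<^sub>k\<^sub>\<in>\<^sub>J z^k / k!)\<close>. Here \<open>J\<close> consists of the orders whose moments need not vanish:
  all \<open>k \<ge> 2\<close> for centred variables, the positive even \<open>k\<close> for symmetric ones. The bound is
  attained in the limit by \<open>n\<close> identically distributed rare jumps, whose sum tends to a centred
  Poisson variable, respectively to a difference of two Poisson variables. Since
  \<open>exp (c (e^z - 1))\<close> generates \<open>\<Sum>\<^sub>r c^r s(k,r)\<close>, the coefficients are the stated sums.\<close>

section \<open>Coefficients of exponentials of formal power series\<close>

unbundle fps_syntax

lemma fps_exp_compose_rec:
  fixes A :: "real fps"
  assumes "A $ 0 = 0"
  shows "fps_deriv (fps_exp 1 oo A) = fps_deriv A * (fps_exp 1 oo A)"
  using fps_compose_deriv[OF assms, of "fps_exp 1"] by (simp add: mult.commute)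

text \<open>The equation \<open>F' = A' F\<close> expresses the coefficient of order
  \<open>m + 1\<close> through those of order at most \<open>m\<close>, so it has only one solution
  with constant term 1. Identities for exponentials then reduce to checking this equation.\<close>

lemma fps_exp_compose_unique:
  fixes A F :: "real fps"
  assumes "A $ 0 = 0" "F $ 0 = 1" "fps_deriv F = fps_deriv A * F"
  shows "F = fps_exp 1 oo A"
proof -
  let ?E = "fps_exp 1 oo A"
  have "F $ k = ?E $ k" for k
  proof (induction k rule: less_induct)
    case (less k)
    show ?case
    proof (cases k)
      case 0
      then show ?thesis using assms by simp
    next
      case (Suc m)
      have "real (Suc m) * F $ Suc m = (fps_deriv A * F) $ m"
        using assms(3) by (metis Suc_eq_plus1 fps_deriv_nth)
      also have "\<dots> = (fps_deriv A * ?E) $ m"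
        unfolding fps_mult_nth by (intro sum.cong refl) (use less Suc in auto)
      also have "\<dots> = real (Suc m) * ?E $ Suc m"
        using fps_exp_compose_rec[OF assms(1)] by (metis Suc_eq_plus1 fps_deriv_nth)
      finally show ?thesis using Suc by simp
    qed
  qed
  then show ?thesis by (simp add: fps_eq_iff)
qed

lemma fps_exp_compose_add:
  fixes A B :: "real fps"
  assumes "A $ 0 = 0" "B $ 0 = 0"
  shows "fps_exp 1 oo (A + B) = (fps_exp 1 oo A) * (fps_exp 1 oo B)"
  by (rule fps_exp_compose_unique[symmetric])
     (simp_all add: assms fps_exp_compose_rec algebra_simps)

section \<open>Coefficientwise inequalities\<close>

lemma fps_power_nonneg:
  fixes A :: "real fps"
  assumes "\<And>j. 0 \<le> A $ j"
  shows "0 \<le> (A ^ i) $ j"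
  by (induction i arbitrary: j) (auto simp: fps_mult_nth assms intro!: sum_nonneg)

lemma fps_exp_compose_nonneg:
  fixes A :: "real fps"
  assumes "\<And>j. 0 \<le> A $ j"
  shows "0 \<le> (fps_exp 1 oo A) $ j"
  by (auto simp: fps_compose_nth intro!: sum_nonneg fps_power_nonneg assms divide_nonneg_pos)

text \<open>The linear term of the exponential series already gives \<open>A $ j\<close>, and all
  other terms are nonnegative.\<close>

lemma le_fps_exp_compose:
  fixes A :: "real fps"
  assumes "\<And>j. 0 \<le> A $ j" "1 \<le> j"
  shows "A $ j \<le> (fps_exp 1 oo A) $ j"
proof -
  have "A $ j = fps_exp 1 $ 1 * (A ^ 1) $ j" by simp
  also have "\<dots> \<le> (\<Sum>i=0..j. fps_exp 1 $ i * (A ^ i) $ j)"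
    by (rule member_le_sum) (use assms in \<open>auto intro!: divide_nonneg_pos fps_power_nonneg\<close>)
  finally show ?thesis by (simp add: fps_compose_nth)
qed

text \<open>Coefficients of a product up to order \<open>k\<close> involve only coefficients of the
  factors up to order \<open>k\<close>; in this range \<open>B\<close> inherits nonnegativity from
  \<open>A\<close>.\<close>

lemma fps_power_mono:
  fixes A B :: "real fps"
  assumes "\<And>j. 0 \<le> A $ j" "\<And>j. j \<le> k \<Longrightarrow> A $ j \<le> B $ j" "j \<le> k"
  shows "(A ^ i) $ j \<le> (B ^ i) $ j"
  using assms(3)
proof (induction i arbitrary: j)
  case (Suc i)
  have "A $ l * (A ^ i) $ (j - l) \<le> B $ l * (B ^ i) $ (j - l)" if "l \<in> {0..j}" for l
  proof (rule mult_mono)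
    show "0 \<le> B $ l" using assms(1)[of l] assms(2)[of l] that Suc.prems by auto
  qed (use assms fps_power_nonneg that Suc in auto)
  then show ?case by (auto simp: fps_mult_nth intro!: sum_mono)
qed simp

lemma fps_exp_compose_mono:
  fixes A B :: "real fps"
  assumes "\<And>j. 0 \<le> A $ j" "\<And>j. j \<le> k \<Longrightarrow> A $ j \<le> B $ j"
  shows "(fps_exp 1 oo A) $ k \<le> (fps_exp 1 oo B) $ k"
  unfolding fps_compose_nth
  by (intro sum_mono mult_left_mono fps_power_mono assms) auto

text \<open>By the triangle inequality the coefficients of a product are dominated by the
  convolution of absolute values. Each factor is dominated by its own exponential, and the
  exponentials multiply to the exponential of the sum.\<close>

lemma fps_prod_abs_le_exp_compose:
  fixes A P :: "nat \<Rightarrow> real fps"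
  assumes A: "\<And>i. A i $ 0 = 0" "\<And>i j. 0 \<le> A i $ j"
    and P: "\<And>i. P i $ 0 = 1" "\<And>i j. 1 \<le> j \<Longrightarrow> \<bar>P i $ j\<bar> \<le> A i $ j"
  shows "\<bar>(\<Prod>i<n. P i) $ k\<bar> \<le> (fps_exp 1 oo (\<Sum>i<n. A i)) $ k"
proof (induction n arbitrary: k)
  case 0
  then show ?case by simp
next
  case (Suc n)
  have nth0: "(\<Sum>i<n. A i) $ 0 = 0" by (simp add: fps_sum_nth A)
  have le: "\<bar>P n $ j\<bar> \<le> (fps_exp 1 oo A n) $ j" for j
  proof (cases "j = 0")
    case False
    then show ?thesis
      using P(2)[of j n] le_fps_exp_compose[of "A n" j] A(2) by fastforce
  qed (simp add: P)
  have "\<bar>(\<Prod>i<Suc n. P i) $ k\<bar> \<le> (\<Sum>j=0..k. \<bar>(\<Prod>i<n. P i) $ j\<bar> * \<bar>P n $ (k - j)\<bar>)"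
    by (simp add: fps_mult_nth flip: abs_mult)
  also have "\<dots> \<le> (\<Sum>j=0..k. (fps_exp 1 oo (\<Sum>i<n. A i)) $ j * (fps_exp 1 oo A n) $ (k - j))"
    by (intro sum_mono mult_mono Suc.IH le fps_exp_compose_nonneg)
       (auto simp: fps_sum_nth intro!: sum_nonneg A)
  also have "\<dots> = (fps_exp 1 oo (\<Sum>i<Suc n. A i)) $ k"
    by (simp add: fps_exp_compose_add[OF nth0 A(1)] fps_mult_nth)
  finally show ?case .
qed

text \<open>The power \<open>F = P^n\<close> satisfies \<open>P F' = n P' F\<close>, which determines the coefficients of
  \<open>F\<close> recursively; as \<open>P \<longlonglongrightarrow> 1\<close> and \<open>n P' \<longlonglongrightarrow> A'\<close>, it becomes \<open>F' = A' F\<close> in the limit.\<close>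

lemma fps_power_tendsto_exp_compose:
  fixes P :: "nat \<Rightarrow> real fps" and A :: "real fps"
  assumes P0: "\<And>n. P n $ 0 = 1" and A0: "A $ 0 = 0"
    and lim: "\<And>j. 1 \<le> j \<Longrightarrow> (\<lambda>n. real n * P n $ j) \<longlonglongrightarrow> A $ j"
  shows "(\<lambda>n. (P n ^ n) $ k) \<longlonglongrightarrow> (fps_exp 1 oo A) $ k"
proof (induction k rule: less_induct)
  case (less k)
  show ?case
  proof (cases k)
    case 0
    then show ?thesis by (simp add: fps_power_zeroth P0)
  next
    case (Suc m)
    let ?F = "\<lambda>n. P n ^ n" and ?E = "fps_exp 1 oo A"
    have P_lim: "(\<lambda>n. P n $ j) \<longlonglongrightarrow> 0" if "1 \<le> j" for j
    proof -
      have "(\<lambda>n. inverse (real n) * (real n * P n $ j)) \<longlonglongrightarrow> 0 * A $ j"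
        by (intro tendsto_mult lim that lim_inverse_n)
      moreover have "\<forall>\<^sub>F n in sequentially. inverse (real n) * (real n * P n $ j) = P n $ j"
        using eventually_gt_at_top[of "0::nat"] by eventually_elim simp
      ultimately show ?thesis by (simp add: tendsto_cong)
    qed
    have ode: "P n * fps_deriv (?F n) = of_nat n * fps_deriv (P n) * ?F n" for n
    proof (cases n)
      case (Suc l)
      show ?thesis by (simp only: Suc fps_deriv_power' diff_Suc_1) (simp only: power_Suc mult_ac)
    qed simp
    \<comment> \<open>The term of \<open>P F'\<close> with \<open>i = m\<close> carries the factor
      \<open>P n $ 0 = 1\<close>. Isolating it leaves only coefficients of \<open>F\<close> of order
      at most \<open>m\<close> on the right.\<close>
    have rec: "real (Suc m) * ?F n $ Suc m =
        (\<Sum>i=0..m. real (m - i + 1) * ?F n $ i * (real n * P n $ (m - i + 1)))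
        - (\<Sum>i=0..<m. P n $ (m - i) * (real (i + 1) * ?F n $ (i + 1)))" for n
    proof -
      have "(fps_deriv (?F n) * P n) $ m = (?F n * (of_nat n * fps_deriv (P n))) $ m"
        using ode[of n] by (simp add: mult_ac)
      then have "(\<Sum>i=0..m. real (i + 1) * ?F n $ (i + 1) * P n $ (m - i)) =
        (\<Sum>i=0..m. ?F n $ i * (real n * (real (m - i + 1) * P n $ (m - i + 1))))"
        by (simp add: fps_mult_nth[of _ _ m] fps_of_nat[symmetric] del: fps_of_nat)
      moreover have "(\<Sum>i=0..m. real (i + 1) * ?F n $ (i + 1) * P n $ (m - i)) =
          (\<Sum>i=0..<m. P n $ (m - i) * (real (i + 1) * ?F n $ (i + 1))) + real (Suc m) * ?F n $ Suc m"
        by (simp add: atLeast0AtMost lessThan_Suc_atMost[symmetric] atLeast0LessThan P0 mult_ac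
            del: of_nat_Suc)
      ultimately show ?thesis by (simp add: mult_ac)
    qed
    have "(\<lambda>n. (\<Sum>i=0..m. real (m - i + 1) * ?F n $ i * (real n * P n $ (m - i + 1)))
        - (\<Sum>i=0..<m. P n $ (m - i) * (real (i + 1) * ?F n $ (i + 1)))) \<longlonglongrightarrow>
        (\<Sum>i=0..m. real (m - i + 1) * ?E $ i * A $ (m - i + 1))
        - (\<Sum>i=0..<m. 0 * (real (i + 1) * ?E $ (i + 1)))"
      by (intro tendsto_diff tendsto_sum tendsto_mult tendsto_const less.IH lim P_lim)
         (auto simp: Suc)
    moreover have "(\<Sum>i=0..m. real (m - i + 1) * ?E $ i * A $ (m - i + 1)) = real (Suc m) * ?E $ Suc m"
    proof -
      have "fps_deriv ?E = ?E * fps_deriv A"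
        by (simp add: fps_exp_compose_rec[OF A0] mult.commute)
      then have "real (Suc m) * ?E $ Suc m = (?E * fps_deriv A) $ m"
        by (metis Suc_eq_plus1 fps_deriv_nth)
      then show ?thesis by (simp only: fps_mult_nth fps_deriv_nth) (simp add: mult_ac)
    qed
    ultimately have "(\<lambda>n. real (Suc m) * ?F n $ Suc m) \<longlonglongrightarrow> real (Suc m) * ?E $ Suc m"
      unfolding rec by simp
    then show ?thesis unfolding Suc
      by (subst (asm) tendsto_mult_left_iff) auto
  qed
qed

section \<open>Stirling numbers and set partitions\<close>

text \<open>For \<open>E = e^(s z) - 1\<close> and \<open>q > 0\<close> one has
  \<open>(E^q)' = s q (E^q + E^(q - 1))\<close>; comparing coefficients turns this into the
  recurrence for the Stirling numbers.\<close>

lemma fps_exp_minus_one_power_nth: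
  "((fps_exp s - 1 :: real fps) ^ q) $ k = s ^ k * fact q * real (Stirling k q) / fact k"
proof (induction k arbitrary: q)
  case 0
  then show ?case by (cases q) auto
next
  case (Suc k)
  show ?case
  proof (cases q)
    case (Suc r)
    let ?E = "fps_exp s - 1 :: real fps"
    have "fps_deriv (?E ^ Suc r) = fps_const (s * real (Suc r)) * (?E ^ Suc r + ?E ^ r)"
    proof -
      have "fps_deriv ?E = fps_const s * (?E + 1)"
        by simp
      then have "fps_deriv (?E ^ Suc r) = of_nat (Suc r) * (fps_const s * (?E + 1)) * ?E ^ r"
        unfolding fps_deriv_power' by simp
      also have "\<dots> = (fps_const s * of_nat (Suc r)) * (?E ^ Suc r + ?E ^ r)"
        by (simp only: power_Suc ring_distribs mult_ac mult_1_left mult_1_right)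
      finally show ?thesis by (simp only: fps_of_nat[symmetric] fps_const_mult)
    qed
    then have "real (Suc k) * (?E ^ Suc r) $ Suc k = s * real (Suc r) * ((?E ^ Suc r) $ k + (?E ^ r) $ k)"
      by (metis Suc_eq_plus1 fps_add_nth fps_deriv_nth fps_mult_left_const_nth)
    also have "\<dots> = s * real (Suc r) * (s ^ k * fact (Suc r) * real (Stirling k (Suc r)) / fact k
        + s ^ k * fact r * real (Stirling k r) / fact k)"
      by (simp only: Suc.IH)
    also have "\<dots> = s ^ Suc k * fact (Suc r) * real (Stirling (Suc k) (Suc r)) / fact k"
      by (simp add: field_simps)
    finally have "(?E ^ Suc r) $ Suc k
        = s ^ Suc k * fact (Suc r) * real (Stirling (Suc k) (Suc r)) / fact k / real (Suc k)"
      by (simp only: eq_divide_eq mult.commute[of _ "real (Suc k)"]) simp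
    then show ?thesis by (simp only: Suc fact_Suc of_nat_mult divide_divide_eq_left mult_ac)
  qed simp
qed

text \<open>The sum is the Touchard polynomial at \<open>c\<close>. In probabilistic terms,
  \<open>c\<close> is the rate of a Poisson variable and \<open>s\<close> the jump size;
  \<open>s = -1\<close> is the source of alternating signs.\<close>

lemma touchard_egf:
  "(fps_exp 1 oo (fps_const c * (fps_exp s - 1))) $ k =
    s ^ k / fact k * (\<Sum>q=0..k. c ^ q * real (Stirling k q))"
proof -
  have "(fps_exp 1 oo (fps_const c * (fps_exp s - 1))) $ k =
      (\<Sum>q=0..k. 1 / fact q * (c ^ q * (s ^ k * fact q * real (Stirling k q) / fact k)))"
    by (simp add: fps_compose_nth power_mult_distrib fps_const_power fps_exp_minus_one_power_nth)
  also have "\<dots> = s ^ k / fact k * (\<Sum>q=0..k. c ^ q * real (Stirling k q))"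
    by (simp add: sum_distrib_left mult_ac)
  finally show ?thesis .
qed

text \<open>The cumulant generating function of the limit law: \<open>e^z - 1 - z\<close> for
  \<open>{2..}\<close> (centred Poisson of rate 1), and \<open>cosh z - 1\<close> for the positive
  even numbers (difference of two independent Poisson variables of rate 1/2).\<close>

definition indicator_egf :: "nat set \<Rightarrow> real fps" where
  "indicator_egf J = Abs_fps (\<lambda>j. indicator J j / fact j)"

text \<open>By the exponential formula, the number of partitions of a \<open>k\<close>-element set into blocks with
  sizes in \<open>J\<close>.\<close>

definition block_partition_count :: "nat set \<Rightarrow> nat \<Rightarrow> real" where
  "block_partition_count J k = fact k * (fps_exp 1 oo indicator_egf J) $ k"

text \<open>Binomial convolution. The index \<open>l\<close> is attached to the second factor, which
  contributes the signs \<open>(-1) ^ l\<close> in both applications.\<close>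

lemma fact_fps_mult_nth:
  fixes F G :: "real fps"
  shows "fact n * (F * G) $ n = (\<Sum>l=0..n. real (n choose l) * (fact (n - l) * F $ (n - l)) * (fact l * G $ l))"
proof -
  have "fact n * (F * G) $ n = (\<Sum>l=0..n. fact n * (G $ l * F $ (n - l)))"
    by (subst mult.commute[of F]) (simp add: fps_mult_nth sum_distrib_left)
  also have "\<dots> = (\<Sum>l=0..n. real (n choose l) * (fact (n - l) * F $ (n - l)) * (fact l * G $ l))"
    by (intro sum.cong refl) (auto simp: binomial_fact)
  finally show ?thesis .
qed

text \<open>Split \<open>e^z - 1 - z\<close> into \<open>e^z - 1\<close>, whose exponential
  generates the row sums of the Stirling numbers, and \<open>-z\<close>, whose exponential
  \<open>e^(-z)\<close> contributes the signs.\<close>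

lemma block_partition_count_no_singletons:
  "block_partition_count {2..} k =
    (\<Sum>l=0..k. (-1) ^ l * real (k choose l) * (\<Sum>r=0..k-l. real (Stirling (k - l) r)))"
proof -
  have "indicator_egf {2..} = (fps_exp 1 - 1) + (- fps_X)"
    by (rule fps_ext) (auto simp: indicator_egf_def indicator_def not_le less_2_cases_iff)
  moreover have "fps_exp 1 oo (- fps_X) = (fps_exp (-1) :: real fps)"
    using fps_exp_compose_linear[of 1 "-1::real"] by (simp flip: fps_const_neg)
  ultimately have "fps_exp 1 oo indicator_egf {2..}
      = (fps_exp 1 oo (fps_const 1 * (fps_exp 1 - 1))) * fps_exp (-1)"
    using fps_exp_compose_add[of "fps_exp 1 - 1" "- fps_X"] by simp
  then show ?thesis
    by (simp only: block_partition_count_def fact_fps_mult_nth touchard_egf) (simp add: mult_ac)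
qed

text \<open>\<open>cosh z - 1\<close> is the mean of \<open>e^z - 1\<close> and
  \<open>e^(-z) - 1\<close>, so its exponential is a product of two Touchard series with
  \<open>c = 1/2\<close>, one for each sign of the jump.\<close>

lemma block_partition_count_even:
  "block_partition_count {j. even j \<and> 0 < j} k =
    (\<Sum>l=0..k. (-1) ^ l * real (k choose l) *
      (\<Sum>q=0..k-l. \<Sum>r=0..l. 2 powi (- int r - int q) * real (Stirling (k - l) q) * real (Stirling l r)))"
proof -
  have weight: "(1/2::real) ^ q * a * ((1/2) ^ r * b) = 2 powi (- int r - int q) * a * b" for q r a b
    by (simp add: power_int_diff power_int_minus power_divide field_simps)
  have "indicator_egf {j. even j \<and> 0 < j}
      = fps_const (1/2) * (fps_exp 1 - 1) + fps_const (1/2) * (fps_exp (-1) - 1)"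
    by (rule fps_ext) (auto simp: indicator_egf_def indicator_def)
  then have "fps_exp 1 oo indicator_egf {j. even j \<and> 0 < j}
      = (fps_exp 1 oo (fps_const (1/2) * (fps_exp 1 - 1))) * (fps_exp 1 oo (fps_const (1/2) * (fps_exp (-1) - 1)))"
    by (simp add: fps_exp_compose_add)
  then have "block_partition_count {j. even j \<and> 0 < j} k =
    (\<Sum>l=0..k. real (k choose l) * (\<Sum>q=0..k-l. (1/2) ^ q * real (Stirling (k - l) q)) *
      ((-1) ^ l * (\<Sum>r=0..l. (1/2) ^ r * real (Stirling l r))))"
    by (simp add: block_partition_count_def fact_fps_mult_nth touchard_egf)
  also have "\<dots> = (\<Sum>l=0..k. (-1) ^ l * real (k choose l) *
      (\<Sum>q=0..k-l. \<Sum>r=0..l. ((1/2) ^ q * real (Stirling (k - l) q)) * ((1/2) ^ r * real (Stirling l r))))"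
    by (simp only: sum_product mult.assoc mult.left_commute[of _ "(-1) ^ _"])
  finally show ?thesis unfolding weight .
qed

section \<open>Moments of sums of independent variables\<close>

definition moment_egf :: "'a measure \<Rightarrow> ('a \<Rightarrow> real) \<Rightarrow> real fps" where
  "moment_egf M X = Abs_fps (\<lambda>k. (\<integral>\<omega>. X \<omega> ^ k \<partial>M) / fact k)"

lemma moment_egf_nth: "moment_egf M X $ k = (\<integral>\<omega>. X \<omega> ^ k \<partial>M) / fact k"
  by (simp add: moment_egf_def)

text \<open>The last summand is independent of the preceding partial sum, so each term of the
  binomial expansion factors. Integrability is carried through the induction because factoring the
  integrals requires it.\<close>

lemma (in prob_space) moment_egf_sum:
  fixes X :: "nat \<Rightarrow> 'a \<Rightarrow> real"
  assumes indep: "indep_vars (\<lambda>_. borel) X UNIV"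
    and int: "\<And>i k. k \<le> p \<Longrightarrow> integrable M (\<lambda>\<omega>. X i \<omega> ^ k)"
    and "k \<le> p"
  shows "integrable M (\<lambda>\<omega>. (\<Sum>i<n. X i \<omega>) ^ k) \<and>
    moment_egf M (\<lambda>\<omega>. \<Sum>i<n. X i \<omega>) $ k = (\<Prod>i<n. moment_egf M (X i)) $ k"
  using \<open>k \<le> p\<close>
proof (induction n arbitrary: k)
  case 0
  then show ?case by (cases k) (auto simp: moment_egf_nth prob_space)
next
  case (Suc n)
  let ?S = "\<lambda>\<omega>. \<Sum>i<n. X i \<omega>"
  have "indep_var borel (X n) borel ?S"
    using indep by (intro indep_vars_sum) (auto intro: indep_vars_subset)
  then have ind: "indep_var borel (\<lambda>\<omega>. X n \<omega> ^ l) borel (\<lambda>\<omega>. ?S \<omega> ^ (k - l))" for l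
    using indep_var_compose[of borel "X n" borel ?S "\<lambda>x. x ^ l" borel "\<lambda>x. x ^ (k - l)" borel]
    by (simp add: comp_def)
  have factor: "integrable M (\<lambda>\<omega>. X n \<omega> ^ l * ?S \<omega> ^ (k - l))"
    "(\<integral>\<omega>. X n \<omega> ^ l * ?S \<omega> ^ (k - l) \<partial>M) = (\<integral>\<omega>. X n \<omega> ^ l \<partial>M) * (\<integral>\<omega>. ?S \<omega> ^ (k - l) \<partial>M)"
    if "l \<in> {0..k}" for l
  proof -
    have "integrable M (\<lambda>\<omega>. X n \<omega> ^ l)" "integrable M (\<lambda>\<omega>. ?S \<omega> ^ (k - l))"
      using that Suc int[of l n] by auto
    then show "integrable M (\<lambda>\<omega>. X n \<omega> ^ l * ?S \<omega> ^ (k - l))"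
      "(\<integral>\<omega>. X n \<omega> ^ l * ?S \<omega> ^ (k - l) \<partial>M) = (\<integral>\<omega>. X n \<omega> ^ l \<partial>M) * (\<integral>\<omega>. ?S \<omega> ^ (k - l) \<partial>M)"
      using indep_var_integrable[OF ind] indep_var_lebesgue_integral[OF ind] by blast+
  qed
  have expand: "(\<Sum>i<Suc n. X i \<omega>) ^ k = (\<Sum>l=0..k. real (k choose l) * (X n \<omega> ^ l * ?S \<omega> ^ (k - l)))" for \<omega>
    using binomial_ring[of "X n \<omega>" "?S \<omega>" k]
    by (simp add: add.commute atLeast0AtMost mult.assoc)
  have "(\<integral>\<omega>. (\<Sum>i<Suc n. X i \<omega>) ^ k \<partial>M) =
      (\<Sum>l=0..k. real (k choose l) * ((\<integral>\<omega>. X n \<omega> ^ l \<partial>M) * (\<integral>\<omega>. ?S \<omega> ^ (k - l) \<partial>M)))"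
    unfolding expand by (subst Bochner_Integration.integral_sum) (simp_all add: factor)
  also have "\<dots> / fact k = (\<Sum>l=0..k. moment_egf M (X n) $ l * moment_egf M ?S $ (k - l))"
    unfolding sum_divide_distrib moment_egf_nth
    by (intro sum.cong refl) (auto simp: binomial_fact)
  also have "\<dots> = (\<Sum>l=0..k. moment_egf M (X n) $ l * (\<Prod>i<n. moment_egf M (X i)) $ (k - l))"
    using Suc by (intro sum.cong refl) auto
  also have "\<dots> = (\<Prod>i<Suc n. moment_egf M (X i)) $ k"
    by (subst prod.lessThan_Suc, subst mult.commute) (simp add: fps_mult_nth)
  finally have "moment_egf M (\<lambda>\<omega>. \<Sum>i<Suc n. X i \<omega>) $ k = (\<Prod>i<Suc n. moment_egf M (X i)) $ k"
    by (simp add: moment_egf_nth)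
  moreover have "integrable M (\<lambda>\<omega>. (\<Sum>i<Suc n. X i \<omega>) ^ k)"
    unfolding expand by (intro Bochner_Integration.integrable_sum integrable_mult_right factor)
  ultimately show ?case by blast
qed

section \<open>Moment bounds by interpolation\<close>

lemma (in prob_space) integrable_power_le:
  fixes X :: "'a \<Rightarrow> real"
  assumes "X \<in> borel_measurable M" "integrable M (\<lambda>\<omega>. \<bar>X \<omega>\<bar> ^ p)" "k \<le> p"
  shows "integrable M (\<lambda>\<omega>. X \<omega> ^ k)"
proof (rule Bochner_Integration.integrable_bound)
  show "integrable M (\<lambda>\<omega>. 1 + \<bar>X \<omega>\<bar> ^ p)" using assms by simp
  have "\<bar>x\<bar> ^ k \<le> 1 + \<bar>x\<bar> ^ p" for x :: real
  proof (cases "\<bar>x\<bar> \<le> 1")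
    case True
    then have "\<bar>x\<bar> ^ k \<le> 1" by (simp add: power_le_one)
    then show ?thesis by (simp add: add_increasing2)
  next
    case False
    then have "\<bar>x\<bar> ^ k \<le> \<bar>x\<bar> ^ p" using assms(3) by (simp add: power_increasing)
    then show ?thesis by simp
  qed
  then show "AE \<omega> in M. norm (X \<omega> ^ k) \<le> norm (1 + \<bar>X \<omega>\<bar> ^ p)"
    by (simp add: power_abs)
qed (use assms in measurable)

text \<open>The weight \<open>l\<close> solves \<open>2 * l + p * (1 - l) = k\<close>, so
  \<open>t ^ k\<close> is a weighted geometric mean of \<open>t ^ 2\<close> and
  \<open>t ^ p\<close>.\<close>

lemma power_le_weighted_powers:
  fixes t :: real
  assumes "0 \<le> t" "2 \<le> k" "k \<le> p" "2 < p"
  defines "l \<equiv> (real p - real k) / (real p - 2)"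
  shows "t ^ k \<le> l * t\<^sup>2 + (1 - l) * t ^ p"
proof (cases "t = 0")
  case False
  then have t: "0 < t" using assms by simp
  have l: "0 \<le> l" "l \<le> 1" using assms by (auto simp: l_def field_simps)
  have "2 * l + real p * (1 - l) = real k"
  proof -
    have "l * (real p - 2) = real p - real k" using assms by (simp add: l_def)
    then show ?thesis by (simp add: algebra_simps)
  qed
  then have "t ^ k = t powr (2 * l + real p * (1 - l))"
    using t by (simp add: powr_realpow)
  also have "\<dots> = (t\<^sup>2) powr l * (t ^ p) powr (1 - l)"
  proof -
    have "t\<^sup>2 = t powr 2" "t ^ p = t powr real p" using t by (simp_all add: powr_realpow)
    then show ?thesis by (simp only: powr_powr powr_add)
  qed
  also have "\<dots> \<le> l * t\<^sup>2 + (1 - l) * t ^ p"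
    using Youngs_inequality_0[of l "1 - l" "t\<^sup>2" "t ^ p"] l t by simp
  finally show ?thesis .
qed (use assms in \<open>auto simp: zero_power\<close>)

text \<open>The interpolation weight depends only on \<open>k\<close> and \<open>p\<close>, so the
  pointwise bound can be integrated and summed over \<open>i\<close> with the same weight.\<close>

lemma (in prob_space) sum_power_moment_le:
  fixes X :: "nat \<Rightarrow> 'a \<Rightarrow> real"
  assumes meas [measurable]: "\<And>i. X i \<in> borel_measurable M"
    and int: "\<And>i. integrable M (\<lambda>\<omega>. \<bar>X i \<omega>\<bar> ^ p)"
    and k: "2 \<le> k" "k \<le> p" "2 < p"
    and le: "(\<Sum>i<n. expectation (\<lambda>\<omega>. (X i \<omega>)\<^sup>2)) \<le> 1" "(\<Sum>i<n. expectation (\<lambda>\<omega>. \<bar>X i \<omega>\<bar> ^ p)) \<le> 1"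
  shows "(\<Sum>i<n. \<bar>expectation (\<lambda>\<omega>. X i \<omega> ^ k)\<bar>) \<le> 1"
proof -
  define l where "l = (real p - real k) / (real p - 2)"
  have l: "0 \<le> l" "l \<le> 1" using k by (auto simp: l_def field_simps)
  note [simp] = int integrable_power_le[OF meas int, of 2]
  have "\<bar>expectation (\<lambda>\<omega>. X i \<omega> ^ k)\<bar> \<le>
      l * expectation (\<lambda>\<omega>. (X i \<omega>)\<^sup>2) + (1 - l) * expectation (\<lambda>\<omega>. \<bar>X i \<omega>\<bar> ^ p)" for i
  proof -
    have "\<bar>expectation (\<lambda>\<omega>. X i \<omega> ^ k)\<bar> \<le> expectation (\<lambda>\<omega>. \<bar>X i \<omega> ^ k\<bar>)"
      by (rule integral_abs_bound)
    also have "\<dots> \<le> expectation (\<lambda>\<omega>. l * (X i \<omega>)\<^sup>2 + (1 - l) * \<bar>X i \<omega>\<bar> ^ p)"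
    proof (rule integral_mono)
      show "\<bar>X i \<omega> ^ k\<bar> \<le> l * (X i \<omega>)\<^sup>2 + (1 - l) * \<bar>X i \<omega>\<bar> ^ p" for \<omega>
        using power_le_weighted_powers[of "\<bar>X i \<omega>\<bar>" k p] k by (simp add: l_def power_abs)
    qed (use k in \<open>auto intro!: integrable_abs integrable_power_le[OF meas int]\<close>)
    also have "\<dots> = l * expectation (\<lambda>\<omega>. (X i \<omega>)\<^sup>2) + (1 - l) * expectation (\<lambda>\<omega>. \<bar>X i \<omega>\<bar> ^ p)"
      using k by simp
    finally show ?thesis .
  qed
  then have "(\<Sum>i<n. \<bar>expectation (\<lambda>\<omega>. X i \<omega> ^ k)\<bar>) \<le>
      (\<Sum>i<n. l * expectation (\<lambda>\<omega>. (X i \<omega>)\<^sup>2) + (1 - l) * expectation (\<lambda>\<omega>. \<bar>X i \<omega>\<bar> ^ p))"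
    by (rule sum_mono)
  also have "\<dots> = l * (\<Sum>i<n. expectation (\<lambda>\<omega>. (X i \<omega>)\<^sup>2)) + (1 - l) * (\<Sum>i<n. expectation (\<lambda>\<omega>. \<bar>X i \<omega>\<bar> ^ p))"
    by (simp add: sum.distrib sum_distrib_left)
  also have "\<dots> \<le> l * 1 + (1 - l) * 1"
    using l le by (intro add_mono mult_left_mono) auto
  finally show ?thesis by simp
qed

lemma (in prob_space) moment_sum_le_normalised:
  fixes X :: "nat \<Rightarrow> 'a \<Rightarrow> real"
  assumes indep: "indep_vars (\<lambda>_. borel) X UNIV"
    and int: "\<And>i. integrable M (\<lambda>\<omega>. \<bar>X i \<omega>\<bar> ^ p)"
    and p: "2 < p" and J: "J \<subseteq> {2..}"
    and vanish: "\<And>i j. \<lbrakk>1 \<le> j; j \<le> p; j \<notin> J\<rbrakk> \<Longrightarrow> expectation (\<lambda>\<omega>. X i \<omega> ^ j) = 0"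
    and le: "(\<Sum>i<n. expectation (\<lambda>\<omega>. (X i \<omega>)\<^sup>2)) \<le> 1" "(\<Sum>i<n. expectation (\<lambda>\<omega>. \<bar>X i \<omega>\<bar> ^ p)) \<le> 1"
  shows "expectation (\<lambda>\<omega>. (\<Sum>i<n. X i \<omega>) ^ p) \<le> block_partition_count J p"
proof -
  have meas [measurable]: "X i \<in> borel_measurable M" for i
    using indep by (auto simp: indep_vars_def)
  define A where "A i = Abs_fps (\<lambda>j. if j = 0 then 0 else \<bar>expectation (\<lambda>\<omega>. X i \<omega> ^ j)\<bar> / fact j)" for i
  have "expectation (\<lambda>\<omega>. (\<Sum>i<n. X i \<omega>) ^ p) = fact p * (\<Prod>i<n. moment_egf M (X i)) $ p"
    using moment_egf_sum[OF indep integrable_power_le[OF meas int], of p p n]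
    by (simp add: moment_egf_nth field_simps)
  also have "\<dots> \<le> fact p * (fps_exp 1 oo (\<Sum>i<n. A i)) $ p"
  proof (rule mult_left_mono)
    \<comment> \<open>By the choice of \<open>A\<close> the coefficient hypothesis holds with
      equality at every positive order, including orders above \<open>p\<close>, where a moment may
      fail to exist and its integral is then 0 by default.\<close>
    have "\<bar>(\<Prod>i<n. moment_egf M (X i)) $ p\<bar> \<le> (fps_exp 1 oo (\<Sum>i<n. A i)) $ p"
      by (rule fps_prod_abs_le_exp_compose) (auto simp: A_def moment_egf_nth prob_space)
    then show "(\<Prod>i<n. moment_egf M (X i)) $ p \<le> (fps_exp 1 oo (\<Sum>i<n. A i)) $ p" by linarith
  qed simp
  also have "\<dots> \<le> fact p * (fps_exp 1 oo indicator_egf J) $ p"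
  proof (intro mult_left_mono fps_exp_compose_mono)
    \<comment> \<open>Only orders up to \<open>p\<close> enter the coefficient of order
      \<open>p\<close>. Orders in \<open>J\<close> are controlled by interpolation; the others have
      vanishing moments, or are the deleted constant term.\<close>
    fix j assume "j \<le> p"
    show "(\<Sum>i<n. A i) $ j \<le> indicator_egf J $ j"
    proof (cases "j \<in> J")
      case True
      then have "2 \<le> j" using J by auto
      then have "(\<Sum>i<n. \<bar>expectation (\<lambda>\<omega>. X i \<omega> ^ j)\<bar>) / fact j \<le> 1 / fact j"
        using sum_power_moment_le[OF meas int _ \<open>j \<le> p\<close> p le]
        by (intro divide_right_mono) auto
      then show ?thesis using True \<open>2 \<le> j\<close>
        by (simp add: A_def fps_sum_nth indicator_egf_def sum_divide_distrib)
    next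
      case False
      then have "A i $ j = 0" for i
        using vanish[of j i] \<open>j \<le> p\<close> by (auto simp: A_def)
      then show ?thesis using False by (simp add: fps_sum_nth indicator_egf_def)
    qed
  qed (auto simp: A_def fps_sum_nth intro!: sum_nonneg)
  finally show ?thesis by (simp add: block_partition_count_def)
qed

text \<open>Homogeneity: \<open>X i / D\<close> satisfies the normalised bounds, and the
  \<open>p\<close>-th moment of the sum scales by \<open>D ^ p\<close>.\<close>

lemma (in prob_space) moment_sum_le:
  fixes X :: "nat \<Rightarrow> 'a \<Rightarrow> real"
  assumes indep: "indep_vars (\<lambda>_. borel) X UNIV"
    and int: "\<And>i. integrable M (\<lambda>\<omega>. \<bar>X i \<omega>\<bar> ^ p)"
    and p: "2 < p" and J: "J \<subseteq> {2..}"
    and vanish: "\<And>i j. \<lbrakk>1 \<le> j; j \<le> p; j \<notin> J\<rbrakk> \<Longrightarrow> expectation (\<lambda>\<omega>. X i \<omega> ^ j) = 0"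
    and D: "0 < D"
    and le: "(\<Sum>i<n. expectation (\<lambda>\<omega>. (X i \<omega>)\<^sup>2)) \<le> D\<^sup>2"
      "(\<Sum>i<n. expectation (\<lambda>\<omega>. \<bar>X i \<omega>\<bar> ^ p)) \<le> D ^ p"
  shows "expectation (\<lambda>\<omega>. (\<Sum>i<n. X i \<omega>) ^ p) \<le> D ^ p * block_partition_count J p"
proof -
  have "expectation (\<lambda>\<omega>. (\<Sum>i<n. X i \<omega> / D) ^ p) \<le> block_partition_count J p"
  proof (rule moment_sum_le_normalised)
    show "indep_vars (\<lambda>_. borel) (\<lambda>i \<omega>. X i \<omega> / D) UNIV"
      using indep_vars_compose2[OF indep, of "\<lambda>_ x. x / D" "\<lambda>_. borel"] by simp
  qed (use assms in \<open>auto simp: power_divide simp flip: sum_divide_distrib\<close>)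
  then show ?thesis using D
    by (simp add: power_divide field_simps flip: sum_divide_distrib)
qed

text \<open>In a product of series with constant term 1 and no linear term, the quadratic
  coefficients add up without cross terms.\<close>

lemma (in prob_space) second_moment_sum:
  fixes X :: "nat \<Rightarrow> 'a \<Rightarrow> real"
  assumes indep: "indep_vars (\<lambda>_. borel) X UNIV"
    and int: "\<And>i. integrable M (\<lambda>\<omega>. X i \<omega> ^ 2)"
    and mean: "\<And>i. expectation (X i) = 0"
  shows "expectation (\<lambda>\<omega>. (\<Sum>i<n. X i \<omega>)\<^sup>2) = (\<Sum>i<n. expectation (\<lambda>\<omega>. (X i \<omega>)\<^sup>2))"
proof -
  have meas: "X i \<in> borel_measurable M" for i
    using indep by (auto simp: indep_vars_def)
  have "integrable M (\<lambda>\<omega>. X i \<omega> ^ k)" if "k \<le> 2" for i k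
    using int[of i] that by (intro integrable_power_le[OF meas, where p = 2]) auto
  from moment_egf_sum[OF indep this, of 2 2 n]
  have "expectation (\<lambda>\<omega>. (\<Sum>i<n. X i \<omega>)\<^sup>2) = 2 * (\<Prod>i<n. moment_egf M (X i)) $ 2"
    by (simp add: moment_egf_nth)
  also have "(\<Prod>i<n. moment_egf M (X i)) $ 0 = 1 \<and> (\<Prod>i<n. moment_egf M (X i)) $ 1 = 0 \<and>
      (\<Prod>i<n. moment_egf M (X i)) $ 2 = (\<Sum>i<n. expectation (\<lambda>\<omega>. (X i \<omega>)\<^sup>2)) / 2"
  proof (induction n)
    case (Suc n)
    have "moment_egf M (X n) $ 0 = 1" "moment_egf M (X n) $ 1 = 0"
      "moment_egf M (X n) $ 2 = expectation (\<lambda>\<omega>. (X n \<omega>)\<^sup>2) / 2"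
      by (simp_all add: moment_egf_nth prob_space mean)
    moreover have "(F * G) $ 2 = F $ 0 * G $ 2 + F $ 1 * G $ 1 + F $ 2 * G $ 0"
      "(F * G) $ 1 = F $ 0 * G $ 1 + F $ 1 * G $ 0" for F G :: "real fps"
      by (simp_all add: fps_mult_nth numeral_2_eq_2)
    ultimately show ?case using Suc.IH
      by (simp add: add_divide_distrib)
  qed simp
  then have "2 * (\<Prod>i<n. moment_egf M (X i)) $ 2 = (\<Sum>i<n. expectation (\<lambda>\<omega>. (X i \<omega>)\<^sup>2))" by simp
  finally show ?thesis .
qed

section \<open>The Rosenthal constants\<close>

text \<open>Exponent 0 is excluded since \<open>0 powr 0\<close> is 0 whereas \<open>0 ^ 0\<close>
  is 1.\<close>

lemma abs_powr_real:
  fixes x :: real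
  assumes "0 < p"
  shows "\<bar>x\<bar> powr real p = \<bar>x\<bar> ^ p"
  using assms by (cases "x = 0") (auto simp: powr_realpow zero_power)

lemma pnorm_powr:
  assumes "0 < p"
  shows "pnorm M p X powr p = (\<integral>\<omega>. \<bar>X \<omega>\<bar> powr p \<partial>M)"
  unfolding pnorm_def using assms by (simp add: powr_powr)

lemma rosenthal_denom_eq:
  assumes "0 < p"
  shows "rosenthal_denom M X (real p) n = max ((\<integral>\<omega>. (\<Sum>i<n. X i \<omega>)\<^sup>2 \<partial>M) powr (1 / 2))
    ((\<Sum>i<n. \<integral>\<omega>. \<bar>X i \<omega>\<bar> ^ p \<partial>M) powr (1 / real p))"
proof -
  have "\<bar>x\<bar> powr 2 = x\<^sup>2" for x :: real
    using abs_powr_real[of 2 x] by simp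
  then show ?thesis
    unfolding rosenthal_denom_def using assms by (simp add: pnorm_powr abs_powr_real) (simp add: pnorm_def)
qed

lemma rosenthal_ratio_eq:
  assumes "0 < p" "even p"
  shows "rosenthal_ratio M X (real p) n =
    (\<integral>\<omega>. (\<Sum>i<n. X i \<omega>) ^ p \<partial>M) powr (1 / real p) / rosenthal_denom M X (real p) n"
  unfolding rosenthal_ratio_def pnorm_def using assms by (simp add: abs_powr_real power_even_abs)

lemma powr_inverse_power:
  fixes a :: real
  assumes "0 \<le> a" "0 < p"
  shows "(a powr (1 / real p)) ^ p = a"
  using assms by (simp flip: root_powr_inverse)

lemma power_powr_inverse:
  fixes a :: real
  assumes "0 \<le> a" "0 < p"
  shows "(a ^ p) powr (1 / real p) = a"
  using assms by (simp add: real_root_power_cancel flip: root_powr_inverse)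

lemma powr_inverse_le_imp_le_power:
  fixes a D :: real
  assumes "0 \<le> a" "0 < p" "a powr (1 / real p) \<le> D"
  shows "a \<le> D ^ p"
proof -
  have "a = (a powr (1 / real p)) ^ p"
    using assms by (simp add: powr_inverse_power)
  also have "\<dots> \<le> D ^ p" using assms by (intro power_mono) auto
  finally show ?thesis .
qed

lemma rosenthal_ratio_le:
  assumes seq: "indep_seq_Lp M X (real p)"
    and p: "2 < p" "even p" and J: "J \<subseteq> {2..}"
    and vanish: "\<And>i j. \<lbrakk>1 \<le> j; j \<le> p; j \<notin> J\<rbrakk> \<Longrightarrow> (\<integral>\<omega>. X i \<omega> ^ j \<partial>M) = 0"
    and nz: "rosenthal_denom M X (real p) n \<noteq> 0"
  shows "rosenthal_ratio M X (real p) n \<le> block_partition_count J p powr (1 / real p)"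
proof -
  interpret prob_space M using seq by (simp add: indep_seq_Lp_def)
  have indep: "indep_vars (\<lambda>_. borel) X UNIV" using seq by (simp add: indep_seq_Lp_def)
  have meas: "X i \<in> borel_measurable M" for i
    using indep by (auto simp: indep_vars_def)
  have int: "integrable M (\<lambda>\<omega>. \<bar>X i \<omega>\<bar> ^ p)" for i
    using seq p by (simp add: indep_seq_Lp_def abs_powr_real)
  define D where "D = rosenthal_denom M X (real p) n"
  note D_eq = rosenthal_denom_eq[of p M X n, folded D_def]
  have D: "0 < D"
  proof -
    have "0 \<le> D" using p by (simp add: D_eq le_max_iff_disj)
    then show ?thesis using nz by (simp add: D_def)
  qed
  \<comment> \<open>Order 1 of \<open>vanish\<close> centres the variables, which turns the 2-norm
    of the sum into a sum of second moments, as the scaled moment bound requires.\<close>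
  have "1 \<notin> J" using J by auto
  then have "expectation (X i) = 0" for i using p vanish[of 1 i] by simp
  then have "(\<Sum>i<n. expectation (\<lambda>\<omega>. (X i \<omega>)\<^sup>2)) = expectation (\<lambda>\<omega>. (\<Sum>i<n. X i \<omega>)\<^sup>2)"
    using p by (intro second_moment_sum[symmetric] indep integrable_power_le[OF meas int]) auto
  also have "\<dots> \<le> D\<^sup>2"
    using powr_inverse_le_imp_le_power[of "expectation (\<lambda>\<omega>. (\<Sum>i<n. X i \<omega>)\<^sup>2)" 2 D] p
    by (simp add: D_eq)
  finally have second: "(\<Sum>i<n. expectation (\<lambda>\<omega>. (X i \<omega>)\<^sup>2)) \<le> D\<^sup>2" .
  have "(\<Sum>i<n. expectation (\<lambda>\<omega>. \<bar>X i \<omega>\<bar> ^ p)) \<le> D ^ p"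
    using p by (intro powr_inverse_le_imp_le_power) (auto simp: D_eq intro!: sum_nonneg)
  from moment_sum_le[OF indep int p(1) J vanish D second this]
  have le: "expectation (\<lambda>\<omega>. (\<Sum>i<n. X i \<omega>) ^ p) \<le> D ^ p * block_partition_count J p" .
  have nonneg: "0 \<le> expectation (\<lambda>\<omega>. (\<Sum>i<n. X i \<omega>) ^ p)"
    using p by (intro Bochner_Integration.integral_nonneg) (simp add: zero_le_power_eq)
  have "expectation (\<lambda>\<omega>. (\<Sum>i<n. X i \<omega>) ^ p) powr (1 / real p)
      \<le> (D ^ p * block_partition_count J p) powr (1 / real p)"
    using le nonneg by (intro powr_mono2) auto
  also have "\<dots> = D * block_partition_count J p powr (1 / real p)"
  proof -
    have "(D ^ p) powr (1 / real p) = D"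
      using D p by (intro power_powr_inverse) auto
    \<comment> \<open>The sign follows from the bound itself: multiplied by
      \<open>D ^ p > 0\<close>, the count dominates a nonnegative even moment.\<close>
    moreover have "0 \<le> block_partition_count J p"
      using le nonneg D by (metis dual_order.trans zero_le_mult_iff zero_less_power not_le)
    ultimately show ?thesis using D by (simp add: powr_mult)
  qed
  finally show ?thesis
    using p D by (simp add: rosenthal_ratio_eq flip: D_def) (simp add: field_simps)
qed

section \<open>Independent sequences with a prescribed law\<close>

text \<open>The sample space has the type over which the suprema range, and the coordinates serve as
  the random variables. The push-forward by the identity replaces the discrete sigma-algebra of
  \<open>q\<close> by the Borel one.\<close>

definition iid_measure :: "real pmf \<Rightarrow> (nat \<Rightarrow> real) measure" where
  "iid_measure q = (\<Pi>\<^sub>M i\<in>UNIV. distr (measure_pmf q) borel (\<lambda>x. x))"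

lemma distr_iid_measure_component:
  "distr (iid_measure q) borel (\<lambda>f. f i) = distr (measure_pmf q) borel (\<lambda>x. x)"
proof -
  have "distr (iid_measure q) (distr (measure_pmf q) borel (\<lambda>x. x)) (\<lambda>f. f i)
      = distr (measure_pmf q) borel (\<lambda>x. x)"
    unfolding iid_measure_def
    by (rule distr_PiM_component) (auto intro!: measure_pmf.prob_space_distr)
  moreover have "distr (iid_measure q) (distr (measure_pmf q) borel (\<lambda>x. x)) (\<lambda>f. f i)
      = distr (iid_measure q) borel (\<lambda>f. f i)"
    by (rule distr_cong) auto
  ultimately show ?thesis by simp
qed

lemma prob_space_iid_measure: "prob_space (iid_measure q)"
  unfolding iid_measure_def
  by (intro prob_space_PiM measure_pmf.prob_space_distr) simp

lemma sets_iid_measure: "sets (iid_measure q) = sets (\<Pi>\<^sub>M i\<in>UNIV. borel)"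
  unfolding iid_measure_def by (rule sets_PiM_cong) auto

lemma measurable_iid_measure_component: "(\<lambda>f. f i) \<in> borel_measurable (iid_measure q)"
  by (subst measurable_cong_sets[OF sets_iid_measure refl]) (rule measurable_component_singleton, simp)

lemma integral_iid_measure:
  fixes h :: "real \<Rightarrow> real"
  assumes "h \<in> borel_measurable borel"
  shows "(\<integral>f. h (f i) \<partial>iid_measure q) = measure_pmf.expectation q h"
proof -
  have "(\<integral>f. h (f i) \<partial>iid_measure q) = (\<integral>x. h x \<partial>distr (iid_measure q) borel (\<lambda>f. f i))"
    by (rule integral_distr[symmetric]) (use assms measurable_iid_measure_component in auto)
  also have "\<dots> = measure_pmf.expectation q h"
    unfolding distr_iid_measure_component by (rule integral_distr) (use assms in auto)
  finally show ?thesis .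
qed

lemma integrable_iid_measure:
  fixes h :: "real \<Rightarrow> real"
  assumes "h \<in> borel_measurable borel" "finite (set_pmf q)"
  shows "integrable (iid_measure q) (\<lambda>f. h (f i))"
proof -
  have "integrable (distr (iid_measure q) borel (\<lambda>f. f i)) h"
    unfolding distr_iid_measure_component
    by (subst integrable_distr_eq) (use assms in \<open>auto intro: integrable_measure_pmf_finite\<close>)
  then show ?thesis
    by (subst (asm) integrable_distr_eq) (use assms measurable_iid_measure_component in auto)
qed

text \<open>The joint law of the coordinates is the measure itself, which is the product of their
  marginals; this characterises independence. Finite support supplies the moments.\<close>

lemma indep_seq_Lp_iid_measure:
  assumes "finite (set_pmf q)"
  shows "indep_seq_Lp (iid_measure q) (\<lambda>i f. f i) p"
proof -
  have "distr (iid_measure q) (\<Pi>\<^sub>M i\<in>UNIV. borel) (\<lambda>f. f) = iid_measure q"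
    by (rule distr_id2) (simp add: sets_iid_measure)
  moreover have "iid_measure q = (\<Pi>\<^sub>M i\<in>UNIV. distr (iid_measure q) borel (\<lambda>f. f i))"
    unfolding distr_iid_measure_component by (simp add: iid_measure_def)
  ultimately have "prob_space.indep_vars (iid_measure q) (\<lambda>_. borel) (\<lambda>i f. f i) UNIV"
    by (subst prob_space.indep_vars_iff_distr_eq_PiM[OF prob_space_iid_measure])
       (simp_all add: restrict_def measurable_iid_measure_component)
  then show ?thesis
    using prob_space_iid_measure integrable_iid_measure[of "\<lambda>x. \<bar>x\<bar> powr p"] assms
    by (simp add: indep_seq_Lp_def)
qed

text \<open>The partition into a single block already contributes. Positivity makes
  \<open>powr\<close> continuous at the limit of the \<open>p\<close>-th moments.\<close>

lemma block_partition_count_pos: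
  assumes "p \<in> J" "1 \<le> p" "0 \<notin> J"
  shows "0 < block_partition_count J p"
proof -
  have "0 < indicator_egf J $ p" using assms by (simp add: indicator_egf_def)
  also have "\<dots> \<le> (fps_exp 1 oo indicator_egf J) $ p"
    by (rule le_fps_exp_compose) (use assms in \<open>auto simp: indicator_egf_def\<close>)
  finally show ?thesis by (simp add: block_partition_count_def)
qed

text \<open>\<open>R\<close> stands for either Rosenthal constant. The law \<open>q n\<close> is
  used for exactly \<open>n\<close> summands, a triangular array. By \<open>lim\<close> the
  denominators tend to 1 and the \<open>p\<close>-th moments of the sums to the partition count, so
  the ratios approach the upper bound.\<close>

lemma power_eq_block_partition_count:
  fixes q :: "nat \<Rightarrow> real pmf" and R :: ereal
  assumes p: "2 < p" "even p" and J: "2 \<in> J" "p \<in> J" "0 \<notin> J"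
    and fin: "\<And>n. finite (set_pmf (q n))"
    and mean: "\<And>n. measure_pmf.expectation (q n) (\<lambda>x. x) = 0"
    and lim: "\<And>j. 1 \<le> j \<Longrightarrow> (\<lambda>n. real n * measure_pmf.expectation (q n) (\<lambda>x. x ^ j)) \<longlonglongrightarrow> indicator J j"
    and lower: "\<And>n. rosenthal_denom (iid_measure (q n)) (\<lambda>i f. f i) (real p) n \<noteq> 0 \<Longrightarrow>
      ereal (rosenthal_ratio (iid_measure (q n)) (\<lambda>i f. f i) (real p) n) \<le> R"
    and upper: "R \<le> ereal (block_partition_count J p powr (1 / real p))"
  shows "R ^ p = ereal (block_partition_count J p)"
proof -
  let ?M = "\<lambda>n. iid_measure (q n)" and ?c = "block_partition_count J p"
  define S where "S n f = (\<Sum>i<n. f i)" for n and f :: "nat \<Rightarrow> real"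
  have c: "0 < ?c" using J p by (intro block_partition_count_pos) auto
  have indep: "prob_space.indep_vars (?M n) (\<lambda>_. borel) (\<lambda>i f. f i) UNIV" for n
    using indep_seq_Lp_iid_measure[OF fin] by (auto simp: indep_seq_Lp_def)
  define P where "P n = moment_egf (measure_pmf (q n)) (\<lambda>x. x)" for n
  have mom: "(\<integral>f. S n f ^ k \<partial>?M n) = fact k * (P n ^ n) $ k" for n k
  proof -
    interpret prob_space "?M n" by (rule prob_space_iid_measure)
    have "moment_egf (?M n) (\<lambda>f. f i) = P n" for i
      by (rule fps_ext) (simp add: P_def moment_egf_nth integral_iid_measure[of "\<lambda>x. x ^ _"])
    moreover have "integrable (?M n) (\<lambda>f. f i ^ l)" for i l
      by (rule integrable_iid_measure[OF _ fin]) simp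
    from moment_egf_sum[OF indep this, of k k n]
    have "moment_egf (?M n) (S n) $ k = (\<Prod>i<n. moment_egf (?M n) (\<lambda>f. f i)) $ k"
      by (simp add: S_def[abs_def])
    ultimately show ?thesis
      by (simp add: moment_egf_nth field_simps)
  qed
  have "(\<lambda>n. (P n ^ n) $ p) \<longlonglongrightarrow> (fps_exp 1 oo indicator_egf J) $ p"
  proof (rule fps_power_tendsto_exp_compose)
    fix j :: nat assume "1 \<le> j"
    then have "(\<lambda>n. real n * measure_pmf.expectation (q n) (\<lambda>x. x ^ j) / fact j) \<longlonglongrightarrow> indicator J j / fact j"
      by (intro tendsto_divide lim tendsto_const) auto
    then show "(\<lambda>n. real n * P n $ j) \<longlonglongrightarrow> indicator_egf J $ j"
      by (simp add: P_def moment_egf_nth indicator_egf_def)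
  qed (use J in \<open>auto simp: P_def moment_egf_nth indicator_egf_def\<close>)
  then have "(\<lambda>n. fact p * (P n ^ n) $ p) \<longlonglongrightarrow> ?c"
    unfolding block_partition_count_def by (intro tendsto_mult tendsto_const)
  then have num: "(\<lambda>n. \<integral>f. S n f ^ p \<partial>?M n) \<longlonglongrightarrow> ?c"
    by (simp add: mom)
  have second: "(\<integral>f. (S n f)\<^sup>2 \<partial>?M n) = real n * measure_pmf.expectation (q n) (\<lambda>x. x\<^sup>2)" for n
  proof -
    have "integrable (?M n) (\<lambda>f. (f i)\<^sup>2)" for i
      by (rule integrable_iid_measure[OF _ fin]) simp
    moreover have "(\<integral>f. f i \<partial>?M n) = 0" for i
      by (subst integral_iid_measure) (simp_all add: mean)
    ultimately have "(\<integral>f. (S n f)\<^sup>2 \<partial>?M n) = (\<Sum>i<n. \<integral>f. (f i)\<^sup>2 \<partial>?M n)"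
      unfolding S_def by (rule prob_space.second_moment_sum[OF prob_space_iid_measure indep])
    moreover have "(\<integral>f. (f i)\<^sup>2 \<partial>?M n) = measure_pmf.expectation (q n) (\<lambda>x. x\<^sup>2)" for i
      by (rule integral_iid_measure) simp
    ultimately show ?thesis by simp
  qed
  have "(\<Sum>i<n. \<integral>f. \<bar>f i\<bar> ^ p \<partial>?M n) = real n * measure_pmf.expectation (q n) (\<lambda>x. x ^ p)" for n
  proof -
    have "(\<integral>f. f i ^ p \<partial>?M n) = measure_pmf.expectation (q n) (\<lambda>x. x ^ p)" for i
      by (rule integral_iid_measure) simp
    then show ?thesis using p by (simp add: power_even_abs)
  qed
  then have denom_eq: "rosenthal_denom (?M n) (\<lambda>i f. f i) (real p) n =
      max ((real n * measure_pmf.expectation (q n) (\<lambda>x. x\<^sup>2)) powr (1 / 2))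
        ((real n * measure_pmf.expectation (q n) (\<lambda>x. x ^ p)) powr (1 / real p))" for n
    using p second by (simp add: rosenthal_denom_eq S_def)
  \<comment> \<open>Both entries of the maximum tend to 1, because 2 and \<open>p\<close> lie in
    \<open>J\<close>.\<close>
  have "(\<lambda>n. rosenthal_denom (?M n) (\<lambda>i f. f i) (real p) n) \<longlonglongrightarrow>
      max (indicator J 2 powr (1 / 2)) (indicator J p powr (1 / real p))"
    unfolding denom_eq using J p by (intro tendsto_max tendsto_powr tendsto_const lim) auto
  then have denom: "(\<lambda>n. rosenthal_denom (?M n) (\<lambda>i f. f i) (real p) n) \<longlonglongrightarrow> 1"
    using J by simp
  have "(\<lambda>n. (\<integral>f. S n f ^ p \<partial>?M n) powr (1 / real p) / rosenthal_denom (?M n) (\<lambda>i f. f i) (real p) n)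
      \<longlonglongrightarrow> ?c powr (1 / real p) / 1"
    by (intro tendsto_divide tendsto_powr num denom tendsto_const) (use c in auto)
  then have "(\<lambda>n. rosenthal_ratio (?M n) (\<lambda>i f. f i) (real p) n) \<longlonglongrightarrow> ?c powr (1 / real p)"
    using p by (simp add: rosenthal_ratio_eq S_def)
  then have "(\<lambda>n. ereal (rosenthal_ratio (?M n) (\<lambda>i f. f i) (real p) n)) \<longlonglongrightarrow> ereal (?c powr (1 / real p))"
    by (rule tendsto_ereal)
  \<comment> \<open>\<open>lower\<close> covers only nonzero denominators; as they tend to 1, they
    are eventually positive.\<close>
  moreover have "\<forall>\<^sub>F n in sequentially. ereal (rosenthal_ratio (?M n) (\<lambda>i f. f i) (real p) n) \<le> R"
    using order_tendstoD(1)[OF denom, of 0] lower by (auto elim!: eventually_mono)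
  ultimately have "ereal (?c powr (1 / real p)) \<le> R"
    by (rule tendsto_upperbound) simp
  with upper have "R = ereal (?c powr (1 / real p))" by (rule antisym)
  moreover have "(?c powr (1 / real p)) ^ p = ?c"
    using c p by (intro powr_inverse_power) auto
  ultimately show ?thesis by simp
qed

section \<open>The extremal laws\<close>

text \<open>The sum of \<open>n\<close> independent copies tends to a centred Poisson variable of
  rate 1. For \<open>n = 0\<close>, division by zero gives the point mass at 0, which is still
  centred.\<close>

definition centred_bernoulli_pmf :: "nat \<Rightarrow> real pmf" where
  "centred_bernoulli_pmf n =
    map_pmf (\<lambda>b. if b then 1 - 1 / real n else - (1 / real n)) (bernoulli_pmf (1 / real n))"

lemma expectation_centred_bernoulli_pmf:
  fixes h :: "real \<Rightarrow> real"
  shows "measure_pmf.expectation (centred_bernoulli_pmf n) h =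
    h (1 - 1 / real n) * (1 / real n) + h (- (1 / real n)) * (1 - 1 / real n)"
proof -
  have "1 / real n \<le> 1" by (cases n) auto
  then show ?thesis by (simp add: centred_bernoulli_pmf_def)
qed

text \<open>A random sign with probability \<open>1 / n\<close>, otherwise 0; for
  \<open>n = 0\<close> the point mass at 0. Sums of \<open>n\<close> copies tend to the difference
  of two independent Poisson variables of rate 1/2.\<close>

definition rademacher_mixture_pmf :: "nat \<Rightarrow> real pmf" where
  "rademacher_mixture_pmf n =
    bind_pmf (bernoulli_pmf (1 / real n))
      (\<lambda>b. if b then map_pmf (\<lambda>c. if c then 1 else -1) (bernoulli_pmf (1 / 2)) else return_pmf 0)"

lemma expectation_rademacher_mixture_pmf:
  fixes h :: "real \<Rightarrow> real"
  shows "measure_pmf.expectation (rademacher_mixture_pmf n) h =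
    (h 1 + h (- 1)) / 2 * (1 / real n) + h 0 * (1 - 1 / real n)"
proof -
  have "1 / real n \<le> 1" by (cases n) auto
  then show ?thesis
    unfolding rademacher_mixture_pmf_def
    by (subst pmf_expectation_bind[where A = UNIV]) (auto simp: UNIV_bool add_divide_distrib)
qed

text \<open>Negation fixes the value 0 and exchanges the two signs, which amounts to flipping the
  fair coin.\<close>

lemma rademacher_mixture_pmf_symmetric:
  "map_pmf uminus (rademacher_mixture_pmf n) = rademacher_mixture_pmf n"
proof -
  have "map_pmf Not (bernoulli_pmf (1 / 2)) = bernoulli_pmf (1 / 2)"
  proof (rule pmf_eqI)
    fix b
    have "pmf (map_pmf Not (bernoulli_pmf (1 / 2))) (\<not> \<not> b) = pmf (bernoulli_pmf (1 / 2)) (\<not> b)"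
      by (rule pmf_map_inj') (auto simp: inj_def)
    then show "pmf (map_pmf Not (bernoulli_pmf (1 / 2))) b = pmf (bernoulli_pmf (1 / 2)) b" by simp
  qed
  note Not = this
  have "map_pmf (\<lambda>c. if c then - 1 else 1) (bernoulli_pmf (1 / 2))
      = map_pmf (\<lambda>c. if c then 1 else - 1 :: real) (map_pmf Not (bernoulli_pmf (1 / 2)))"
    unfolding pmf.map_comp by (intro map_pmf_cong) auto
  also have "\<dots> = map_pmf (\<lambda>c. if c then 1 else - 1) (bernoulli_pmf (1 / 2))"
    by (simp only: Not)
  finally have "map_pmf uminus (map_pmf (\<lambda>c. if c then 1 else - 1) (bernoulli_pmf (1 / 2)))
      = map_pmf (\<lambda>c. if c then 1 else - 1 :: real) (bernoulli_pmf (1 / 2))"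
    by (simp add: pmf.map_comp comp_def if_distrib cong: if_cong)
  then show ?thesis
    unfolding rademacher_mixture_pmf_def map_bind_pmf
    by (intro bind_pmf_cong refl) auto
qed

text \<open>Centring removes order 1. For \<open>j\<close> at least 2, the jump contributes
  \<open>(1 - 1/n) ^ j\<close> to \<open>n\<close> times the moment, tending to 1, while the
  compensating drift contributes a term tending to 0.\<close>

lemma Rosenthal_C_power:
  assumes p: "2 < p" "even p"
  shows "Rosenthal_C (real p) ^ p = ereal (block_partition_count {2..} p)"
proof (rule power_eq_block_partition_count[where q = centred_bernoulli_pmf])
  fix j :: nat assume j: "1 \<le> j"
  show "(\<lambda>n. real n * measure_pmf.expectation (centred_bernoulli_pmf n) (\<lambda>x. x ^ j)) \<longlonglongrightarrow> indicator {2..} j"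
  proof (cases "j = 1")
    case True
    then show ?thesis by (simp add: expectation_centred_bernoulli_pmf)
  next
    case False
    then obtain i where i: "j = Suc i" "0 < i" using j by (cases j) auto
    \<comment> \<open>Taking one factor \<open>1 / n\<close> out of each summand cancels the factor
      \<open>n\<close>; the remaining exponent \<open>i\<close> is positive, so the drift term
      vanishes in the limit.\<close>
    have "(\<lambda>n. (1 - 1 / real n) ^ j - (1 - 1 / real n) * (- (1 / real n)) ^ i)
        \<longlonglongrightarrow> (1 - 0) ^ j - (1 - 0) * (- 0) ^ i"
      by (intro tendsto_intros lim_1_over_n)
    moreover have "\<forall>\<^sub>F n in sequentially. (1 - 1 / real n) ^ j - (1 - 1 / real n) * (- (1 / real n)) ^ i
        = real n * measure_pmf.expectation (centred_bernoulli_pmf n) (\<lambda>x. x ^ j)"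
      using eventually_gt_at_top[of "0::nat"]
    proof eventually_elim
      case (elim n)
      define c where "c = 1 / real n"
      have "real n * ((1 - c) ^ j * c + (- c) ^ j * (1 - c))
          = (real n * c) * ((1 - c) ^ j - (1 - c) * (- c) ^ i)"
        unfolding i by (simp add: algebra_simps)
      then show ?case
        using elim by (simp add: expectation_centred_bernoulli_pmf c_def)
    qed
    ultimately have "(\<lambda>n. real n * measure_pmf.expectation (centred_bernoulli_pmf n) (\<lambda>x. x ^ j))
        \<longlonglongrightarrow> (1 - 0) ^ j - (1 - 0) * (- 0) ^ i"
      by (rule Lim_transform_eventually)
    then show ?thesis using i by (simp add: zero_power)
  qed
next
  fix n
  assume "rosenthal_denom (iid_measure (centred_bernoulli_pmf n)) (\<lambda>i f. f i) (real p) n \<noteq> 0"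
  moreover have "centred_seq (iid_measure (centred_bernoulli_pmf n)) (\<lambda>i f. f i) (real p)"
    unfolding centred_seq_def
    by (auto intro!: indep_seq_Lp_iid_measure simp: centred_bernoulli_pmf_def)
       (simp flip: centred_bernoulli_pmf_def
         add: integral_iid_measure[of "\<lambda>x. x"] expectation_centred_bernoulli_pmf)
  ultimately show "ereal (rosenthal_ratio (iid_measure (centred_bernoulli_pmf n)) (\<lambda>i f. f i) (real p) n)
      \<le> Rosenthal_C (real p)"
    by (intro centred_seq_canonical)
next
  show "Rosenthal_C (real p) \<le> ereal (block_partition_count {2..} p powr (1 / real p))"
    unfolding Rosenthal_C_def
  proof (safe intro!: SUP_least)
    fix M :: "(nat \<Rightarrow> real) measure" and X n
    assume seq: "centred_seq M X (real p)" and nz: "rosenthal_denom M X (real p) n \<noteq> 0"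
    show "ereal (rosenthal_ratio M X (real p) n) \<le> ereal (block_partition_count {2..} p powr (1 / real p))"
      unfolding ereal_less_eq
    proof (rule rosenthal_ratio_le[OF _ p _ _ nz])
      fix i j :: nat assume "1 \<le> j" "j \<notin> {2..}"
      then have "j = 1" by simp
      then show "(\<integral>\<omega>. X i \<omega> ^ j \<partial>M) = 0" using seq by (simp add: centred_seq_def)
    qed (use seq in \<open>auto simp: centred_seq_def\<close>)
  qed
qed (use p in \<open>auto simp: expectation_centred_bernoulli_pmf\<close>, simp add: centred_bernoulli_pmf_def)

text \<open>Replacing \<open>X\<close> by \<open>-X\<close> preserves the integral by symmetry and
  reverses its sign by oddness. For a non-integrable power the identity holds with the default value
  0.\<close>

lemma symmetric_odd_moment:
  fixes X :: "'a \<Rightarrow> real"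
  assumes [measurable]: "X \<in> borel_measurable M"
    and sym: "distr M borel (\<lambda>\<omega>. - X \<omega>) = distr M borel X" and "odd j"
  shows "(\<integral>\<omega>. X \<omega> ^ j \<partial>M) = 0"
proof -
  have "(\<integral>\<omega>. X \<omega> ^ j \<partial>M) = (\<integral>x. x ^ j \<partial>distr M borel (\<lambda>\<omega>. - X \<omega>))"
    unfolding sym by (rule integral_distr[symmetric]) simp_all
  also have "\<dots> = (\<integral>\<omega>. (- X \<omega>) ^ j \<partial>M)"
    by (rule integral_distr) simp_all
  also have "\<dots> = - (\<integral>\<omega>. X \<omega> ^ j \<partial>M)"
    using \<open>odd j\<close> by simp
  finally show ?thesis by simp
qed

lemma distr_iid_measure_uminus:
  assumes "map_pmf uminus q = q"
  shows "distr (iid_measure q) borel (\<lambda>f. - f i) = distr (iid_measure q) borel (\<lambda>f. f i)"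
proof -
  have "distr (iid_measure q) borel (\<lambda>f. - f i) = distr (distr (iid_measure q) borel (\<lambda>f. f i)) borel uminus"
    by (subst distr_distr) (simp_all add: comp_def measurable_iid_measure_component)
  also have "\<dots> = distr (measure_pmf q) borel uminus"
    unfolding distr_iid_measure_component by (subst distr_distr) (simp_all add: comp_def)
  also have "\<dots> = distr (measure_pmf (map_pmf uminus q)) borel (\<lambda>x. x)"
    unfolding map_pmf_rep_eq by (subst distr_distr) (simp_all add: comp_def)
  finally show ?thesis by (simp add: assms distr_iid_measure_component)
qed

text \<open>Symmetry removes exactly the odd orders. For \<open>n > 0\<close> and
  \<open>j \<ge> 1\<close>, \<open>n\<close> times the moment of the mixture equals the indicator,
  so the required limit is eventually constant.\<close>

lemma Rosenthal_S_power:
  assumes p: "2 < p" "even p"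
  shows "Rosenthal_S (real p) ^ p = ereal (block_partition_count {j. even j \<and> 0 < j} p)"
proof (rule power_eq_block_partition_count[where q = rademacher_mixture_pmf])
  fix j :: nat assume "1 \<le> j"
  then have "real n * measure_pmf.expectation (rademacher_mixture_pmf n) (\<lambda>x. x ^ j)
      = indicator {j. even j \<and> 0 < j} j" if "0 < n" for n
    using that by (cases "even j") (simp_all add: expectation_rademacher_mixture_pmf zero_power)
  then show "(\<lambda>n. real n * measure_pmf.expectation (rademacher_mixture_pmf n) (\<lambda>x. x ^ j))
      \<longlonglongrightarrow> indicator {j. even j \<and> 0 < j} j"
    by (intro tendsto_eventually) (rule eventually_mono[OF eventually_gt_at_top[of "0::nat"]])
next
  show fin: "finite (set_pmf (rademacher_mixture_pmf n))" for n
    by (auto simp: rademacher_mixture_pmf_def)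
  fix n
  assume "rosenthal_denom (iid_measure (rademacher_mixture_pmf n)) (\<lambda>i f. f i) (real p) n \<noteq> 0"
  moreover have "symmetric_seq (iid_measure (rademacher_mixture_pmf n)) (\<lambda>i f. f i) (real p)"
    unfolding symmetric_seq_def
    by (intro conjI allI indep_seq_Lp_iid_measure fin distr_iid_measure_uminus
        rademacher_mixture_pmf_symmetric)
  ultimately show "ereal (rosenthal_ratio (iid_measure (rademacher_mixture_pmf n)) (\<lambda>i f. f i) (real p) n)
      \<le> Rosenthal_S (real p)"
    by (intro symmetric_seq_canonical)
next
  show "Rosenthal_S (real p) \<le> ereal (block_partition_count {j. even j \<and> 0 < j} p powr (1 / real p))"
    unfolding Rosenthal_S_def
  proof (safe intro!: SUP_least)
    fix M :: "(nat \<Rightarrow> real) measure" and X n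
    assume seq: "symmetric_seq M X (real p)" and nz: "rosenthal_denom M X (real p) n \<noteq> 0"
    have Lp: "indep_seq_Lp M X (real p)"
      and sym: "distr M borel (\<lambda>\<omega>. - X i \<omega>) = distr M borel (X i)" for i
      using seq unfolding symmetric_seq_def by blast+
    have meas: "X i \<in> borel_measurable M" for i
      using Lp unfolding indep_seq_Lp_def by (auto simp: prob_space.indep_vars_def)
    show "ereal (rosenthal_ratio M X (real p) n)
        \<le> ereal (block_partition_count {j. even j \<and> 0 < j} p powr (1 / real p))"
      unfolding ereal_less_eq
    proof (rule rosenthal_ratio_le[OF _ p _ _ nz])
      show "{j::nat. even j \<and> 0 < j} \<subseteq> {2..}" using dvd_imp_le[of 2] by auto
      fix i j :: nat assume "1 \<le> j" "j \<notin> {j. even j \<and> 0 < j}"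
      then have "odd j" by simp
      then show "(\<integral>\<omega>. X i \<omega> ^ j \<partial>M) = 0"
        by (rule symmetric_odd_moment[OF meas sym])
    qed (rule Lp)
  qed
qed (use p in \<open>simp_all add: expectation_rademacher_mixture_pmf\<close>)

section \<open>The Poisson series\<close>

text \<open>The factorial moments of a Poisson variable of rate 1 are all 1: the terms with
  \<open>n < r\<close> contain a zero factor, and shifting by \<open>r\<close> leaves the
  exponential series.\<close>

lemma falling_factorial_exp_sums:
  "(\<lambda>n. (\<Prod>i<r. real n - real i) / fact n) sums exp 1"
proof -
  have shift: "(\<Prod>i<r. real (n + r) - real i) * fact n = fact (n + r)" for n
  proof (induction r)
    case (Suc r)
    have "(\<Prod>i<Suc r. real (n + Suc r) - real i) = real (n + Suc r) * (\<Prod>i<r. real (n + r) - real i)"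
      by (subst prod.lessThan_Suc_shift) simp
    then show ?case using Suc.IH by (simp add: mult.assoc)
  qed simp
  have "(\<lambda>n. (\<Prod>i<r. real (n + r) - real i) / fact (n + r)) = (\<lambda>n. 1 ^ n /\<^sub>R fact n)"
  proof
    fix n
    show "(\<Prod>i<r. real (n + r) - real i) / fact (n + r) = 1 ^ n /\<^sub>R fact n"
      using shift[of n] by (simp add: field_simps)
  qed
  then have "(\<lambda>n. (\<Prod>i<r. real (n + r) - real i) / fact (n + r)) sums exp (1::real)"
    using exp_converges[of "1::real"] by simp
  moreover have "(\<Prod>i<r. real n - real i) = 0" if "n < r" for n
    using that by auto
  ultimately show ?thesis
    by (subst (asm) sums_iff_shift) (simp add: sum.neutral)
qed

text \<open>Dobinski's formula: expand the power in falling factorials and sum each series. The sum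
  of Stirling numbers is the Bell number.\<close>

lemma power_exp_sums:
  "(\<lambda>n. real n ^ p / fact n) sums (exp 1 * (\<Sum>r=0..p. real (Stirling p r)))"
proof -
  have "(\<lambda>n. \<Sum>r\<le>p. real (Stirling p r) * ((\<Prod>i<r. real n - real i) / fact n))
      sums (\<Sum>r\<le>p. real (Stirling p r) * exp 1)"
    by (intro sums_sum sums_mult falling_factorial_exp_sums)
  moreover have "real n ^ p / fact n = (\<Sum>r\<le>p. real (Stirling p r) * ((\<Prod>i<r. real n - real i) / fact n))" for n
    by (subst Stirling_falling_factorial) (simp add: sum_divide_distrib)
  ultimately show ?thesis
    by (simp add: atLeast0AtMost sum_distrib_left mult.commute[of _ "exp 1"])
qed

lemma B1_eq_sum_Stirling: "B1 p = (\<Sum>r=0..p. real (Stirling p r))"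
  using sums_unique[OF power_exp_sums[of p], symmetric] by (simp add: B1_def exp_minus)

text \<open>The moments of a centred Poisson variable, by binomial expansion. The term
  \<open>l = p\<close> relies on \<open>0 ^ 0 = 1\<close> at \<open>n = 0\<close>.\<close>

lemma shifted_power_exp_sums:
  "(\<lambda>n. (real n - 1) ^ p / fact n) sums (exp 1 * (\<Sum>l=0..p. (-1) ^ l * real (p choose l) * B1 (p - l)))"
proof -
  have "(\<lambda>n. \<Sum>l=0..p. (-1) ^ l * real (p choose l) * (real n ^ (p - l) / fact n))
      sums (\<Sum>l=0..p. (-1) ^ l * real (p choose l) * (exp 1 * B1 (p - l)))"
    unfolding B1_eq_sum_Stirling by (intro sums_sum sums_mult power_exp_sums)
  moreover have "(real n - 1) ^ p = (\<Sum>l=0..p. (-1) ^ l * real (p choose l) * real n ^ (p - l))" for n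
    using binomial_ring[of "-1" "real n" p] by (simp add: atLeast0AtMost mult_ac)
  ultimately show ?thesis
    by (simp add: sum_divide_distrib sum_distrib_left mult.left_commute[of "exp 1"])
qed

lemma L_fun_even:
  assumes "even p" "0 < p"
  shows "L_fun (real p) = (\<Sum>l=0..p. (-1) ^ l * real (p choose l) * B1 (p - l))"
  using sums_unique[OF shifted_power_exp_sums[of p], symmetric] assms
  by (simp add: L_fun_def abs_powr_real power_even_abs exp_minus)

text \<open>For odd \<open>p\<close> the absolute value matters only at \<open>n = 0\<close>, where
  it changes -1 into 1. The difference 2 is the source of the summand \<open>2 / e\<close>.\<close>

lemma abs_shifted_power_exp_sums_odd:
  assumes "odd p"
  shows "(\<lambda>n. \<bar>real n - 1\<bar> powr real p / fact n) sums
    (exp 1 * (\<Sum>l=0..p. (-1) ^ l * real (p choose l) * B1 (p - l)) + 2)"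
proof -
  have "0 < p" using assms by (rule odd_pos)
  then have "\<bar>real n - 1\<bar> powr real p / fact n = (real n - 1) ^ p / fact n + (if n = 0 then 2 else 0)" for n
    unfolding abs_powr_real[OF \<open>0 < p\<close>] using assms by (cases n) simp_all
  moreover have "(\<lambda>n. (real n - 1) ^ p / fact n + (if n = 0 then 2 else 0)) sums
      (exp 1 * (\<Sum>l=0..p. (-1) ^ l * real (p choose l) * B1 (p - l)) + 2)"
    by (intro sums_add shifted_power_exp_sums sums_single[of 0 "\<lambda>_. 2"])
  ultimately show ?thesis by simp
qed

lemma L_fun_odd:
  assumes "odd p"
  shows "L_fun (real p) = 2 / exp 1 + (\<Sum>k=0..p. (-1) ^ k * real (p choose k) * B1 (p - k))"
  using sums_unique[OF abs_shifted_power_exp_sums_odd[OF assms], symmetric]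
  by (simp add: L_fun_def exp_minus field_simps)

text \<open>Undoing the root needs \<open>L_fun\<close> nonnegative; this is read off termwise from
  the series once it is known to be summable.\<close>

lemma G_fun_power_odd:
  assumes "odd p"
  shows "G_fun (real p) ^ p = L_fun (real p)"
proof -
  have "0 \<le> L_fun (real p)"
    unfolding L_fun_def
    using sums_summable[OF abs_shifted_power_exp_sums_odd[OF assms]]
    by (intro mult_nonneg_nonneg suminf_nonneg) auto
  then show ?thesis
    unfolding G_fun_def using odd_pos[OF assms] by (rule powr_inverse_power)
qed

theorem theorem4p4:
  shows "(\<forall>m::nat. m \<ge> 2 \<longrightarrow>
      Rosenthal_K (2 * m) =
        ereal (\<Sum>l=0..2*m. (-1) ^ l * real ((2 * m) choose l) *
          (\<Sum>q=0..2*m-l. \<Sum>r=0..l.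
             2 powi (- int r - int q) * real (Stirling (2 * m - l) q) * real (Stirling l r)))
    \<and> Rosenthal_C (real (2 * m)) ^ (2 * m) = ereal (L_fun (real (2 * m)))
    \<and> L_fun (real (2 * m)) =
        (\<Sum>l=0..2*m. (-1) ^ l * real ((2 * m) choose l) *
          (\<Sum>r=0..2*m-l. real (Stirling (2 * m - l) r))))
  \<and> (\<forall>p::nat. odd p \<and> p \<ge> 5 \<longrightarrow>
      G_fun (real p) ^ p = L_fun (real p)
    \<and> L_fun (real p) =
        2 / exp 1 + (\<Sum>k=0..p. (-1) ^ k * real (p choose k) * B1 (p - k)))"
proof (intro conjI allI impI)
  fix m :: nat assume m: "m \<ge> 2"
  then have p: "2 < 2 * m" "even (2 * m)" "0 < 2 * m" by auto
  show "Rosenthal_K (2 * m) =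
        ereal (\<Sum>l=0..2*m. (-1) ^ l * real ((2 * m) choose l) *
          (\<Sum>q=0..2*m-l. \<Sum>r=0..l.
             2 powi (- int r - int q) * real (Stirling (2 * m - l) q) * real (Stirling l r)))"
    unfolding Rosenthal_K_def Rosenthal_S_power[OF p(1,2)] block_partition_count_even ..
  show L: "L_fun (real (2 * m)) =
        (\<Sum>l=0..2*m. (-1) ^ l * real ((2 * m) choose l) *
          (\<Sum>r=0..2*m-l. real (Stirling (2 * m - l) r)))"
    unfolding L_fun_even[OF p(2,3)] B1_eq_sum_Stirling ..
  \<comment> \<open>The two sides meet in the common Stirling sum: the partition count without
    singletons is the centred Poisson moment.\<close>
  show "Rosenthal_C (real (2 * m)) ^ (2 * m) = ereal (L_fun (real (2 * m)))"
    unfolding Rosenthal_C_power[OF p(1,2)] block_partition_count_no_singletons L ..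
next
  fix p :: nat assume "odd p \<and> p \<ge> 5"
  then show "G_fun (real p) ^ p = L_fun (real p)"
    "L_fun (real p) = 2 / exp 1 + (\<Sum>k=0..p. (-1) ^ k * real (p choose k) * B1 (p - k))"
    by (auto intro!: G_fun_power_odd L_fun_odd)
qed

end
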